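(* Let $p,q\ge2$, and let $e:\mathbb{R}^{d\times d}\times\mathbb{R}\to\mathbb{R}$, $e=e(F,\eta)$, satisfy: $e\in C^3$; there are $c,c'>0$ with $c(|F|^p+|\eta|^q-1)\le e(F,\eta)\le c'(|F|^p+|\eta|^q+1)$; there is $C>0$ with $|e_F(F,\eta)|\le C(1+|F|^{p-1}+|\eta|^{q\frac{p-1}{p}})$ and $|e_\eta(F,\eta)|\le C(1+|F|^{p\frac{q-1}{q}}+|\eta|^{q-1})$ (all for all $(F,\eta)$); and $e$ is strongly quasiconvex. Let $K>0$ and let $\omega$ be a modulus of continuity. Then there exist constants $C_0=C_0(e,K)>0$ and $C_1=C_1(e,K)>0$ (possibly depending also on $\omega$) such that for all $(\bar F,\bar\eta)\in\mathcal{U}_K$, all $\psi\in L^q(Q)$ with $\int_Q\psi=0$ and all $\phi\in W^{1,p}_0(Q;\mathbb{R}^d)$, $$\int_Q\big(|V_p(\nabla\phi)|^2+|V_q(\psi)|^2\big)dx\le C_0\int_Q e(\bar F+\nabla\phi,\bar\eta+\psi\,|\,\bar F,\bar\eta)\,dx+C_1\int_Q|V_p(\phi)|^2dx .$$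
   Context: $Q$ is the unit cube $(0,1)^d$ with opposite faces identified (so $C(Q)$ denotes continuous periodic functions). For $s\ge 2$, $V_s(z)=(|z|^s+|z|^2)^{1/2}$. Strong quasiconvexity: there is $c_0>0$ such that for all $(\lambda_1,\lambda_2)\in\mathbb{R}^{d\times d}\times\mathbb{R}$, all $\phi\in W^{1,p}(Q;\mathbb{R}^d)$, $\psi\in L^q(Q)$, $$\int_Q e(\lambda_1+\nabla\phi,\lambda_2+\psi)-e(\lambda_1,\lambda_2)-e_\eta(\lambda_1,\lambda_2)\psi\ \ge\ c_0\int_Q|V_p(\nabla\phi)|^2+|V_q(\psi)|^2 ;$$ equivalently the same with $Q$ replaced by any nonempty open $\Omega\subseteq\mathbb{R}^d$ with $|\partial\Omega|=0$, $\phi\in W^{1,p}_0(\Omega)$, $\psi\in L^q(\Omega)$. Relative energy: $e(z_1,z_2|\bar z_1,\bar z_2)=e(z_1,z_2)-e(\bar z_1,\bar z_2)-e_F(\bar z_1,\bar z_2)\cdot(z_1-\bar z_1)-e_\eta(\bar z_1,\bar z_2)(z_2-\bar z_2)$. $\mathcal{U}_K$ is the set of $(\bar F,\bar\eta)\in C(Q;\mathbb{R}^{d\times d})\times C(Q;\mathbb{R})$ with $\|\bar F\|_{L^\infty(Q)}+\|\bar\eta\|_{L^\infty(Q)}\le K$ and $|\bar F(x)-\bar F(y)|+|\bar\eta(x)-\bar\eta(y)|\le\omega(|x-y|)$ for all $x,y\in\overline Q$. *)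

theory Defs
  imports "HOL-Analysis.Analysis" "HOL-Probability.Essential_Supremum"
begin

primrec Ck :: "nat \<Rightarrow> ('a::euclidean_space \<Rightarrow> 'b::real_normed_vector) \<Rightarrow> bool" where
  "Ck 0 f \<longleftrightarrow> continuous_on UNIV f"
| "Ck (Suc k) f \<longleftrightarrow>
     (\<forall>x. f differentiable (at x)) \<and> (\<forall>v. Ck k (\<lambda>x. frechet_derivative f (at x) v))"

definition test_function :: "'a::euclidean_space set \<Rightarrow> ('a \<Rightarrow> 'b::real_normed_vector) \<Rightarrow> bool" where
  "test_function \<Omega> \<zeta> \<longleftrightarrow>
     (\<forall>k. Ck k \<zeta>) \<and> compact (closure {x. \<zeta> x \<noteq> 0}) \<and> closure {x. \<zeta> x \<noteq> 0} \<subseteq> \<Omega>"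

text \<open>The energy is a function of the pair \<open>(F, \<eta>)\<close>. Its partial gradient in \<open>F\<close> is again a matrix,
  so that \<open>e_F z \<bullet> H\<close>, with the Frobenius inner product, is the derivative in direction \<open>(H, 0)\<close>.\<close>

definition grad_F :: "((real^'d^'d) \<times> real \<Rightarrow> real) \<Rightarrow> (real^'d^'d) \<times> real \<Rightarrow> real^'d^'d" where
  "grad_F e z = (\<chi> i j. frechet_derivative e (at z) (axis i (axis j 1), 0))"

definition deriv_eta :: "((real^'d^'d) \<times> real \<Rightarrow> real) \<Rightarrow> (real^'d^'d) \<times> real \<Rightarrow> real" where
  "deriv_eta e z = frechet_derivative e (at z) (0, 1)"

definition Lp :: "real \<Rightarrow> 'a::euclidean_space set \<Rightarrow> ('a \<Rightarrow> 'b::euclidean_space) set" where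
  "Lp p \<Omega> = {f \<in> borel_measurable (lebesgue_on \<Omega>).
     integrable (lebesgue_on \<Omega>) (\<lambda>x. norm (f x) powr p)}"

definition Linf_norm :: "'a::euclidean_space set \<Rightarrow> ('a \<Rightarrow> 'b::real_normed_vector) \<Rightarrow> ereal" where
  "Linf_norm \<Omega> f = esssup (lebesgue_on \<Omega>) (\<lambda>x. ereal (norm (f x)))"

text \<open>Gradients of vector fields are Jacobian matrices: entry \<open>(i, j)\<close> is the derivative of the
  \<open>i\<close>-th component in the \<open>j\<close>-th coordinate.\<close>

definition weak_gradient ::
  "(real^'d) set \<Rightarrow> (real^'d \<Rightarrow> real^'d) \<Rightarrow> (real^'d \<Rightarrow> real^'d^'d) \<Rightarrow> bool" where
  "weak_gradient \<Omega> \<phi> G \<longleftrightarrow>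
     (\<forall>S. compact S \<and> S \<subseteq> \<Omega> \<longrightarrow> \<phi> absolutely_integrable_on S \<and> G absolutely_integrable_on S) \<and>
     (\<forall>(\<zeta> :: real^'d \<Rightarrow> real) i j. test_function \<Omega> \<zeta> \<longrightarrow>
        (LINT x|lebesgue_on \<Omega>. \<phi> x $ i * frechet_derivative \<zeta> (at x) (axis j 1)) =
        - (LINT x|lebesgue_on \<Omega>. G x $ i $ j * \<zeta> x))"

text \<open>Sobolev functions are carried together with a representative \<open>G\<close> of their (almost everywhere
  unique) weak gradient.\<close>

definition W1p :: "real \<Rightarrow> (real^'d) set \<Rightarrow> (real^'d \<Rightarrow> real^'d) \<Rightarrow> (real^'d \<Rightarrow> real^'d^'d) \<Rightarrow> bool" where
  "W1p p \<Omega> \<phi> G \<longleftrightarrow> \<phi> \<in> Lp p \<Omega> \<and> G \<in> Lp p \<Omega> \<and> weak_gradient \<Omega> \<phi> G"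

definition W1p_norm ::
  "real \<Rightarrow> (real^'d) set \<Rightarrow> (real^'d \<Rightarrow> real^'d) \<Rightarrow> (real^'d \<Rightarrow> real^'d^'d) \<Rightarrow> real" where
  "W1p_norm p \<Omega> \<phi> G =
     (LINT x|lebesgue_on \<Omega>. norm (\<phi> x) powr p + norm (G x) powr p) powr (1 / p)"

definition W1p0 :: "real \<Rightarrow> (real^'d) set \<Rightarrow> (real^'d \<Rightarrow> real^'d) \<Rightarrow> (real^'d \<Rightarrow> real^'d^'d) \<Rightarrow> bool" where
  "W1p0 p \<Omega> \<phi> G \<longleftrightarrow> W1p p \<Omega> \<phi> G \<and>
     (\<exists>u :: nat \<Rightarrow> real^'d \<Rightarrow> real^'d. (\<forall>n. test_function \<Omega> (u n)) \<and>
        (\<lambda>n. W1p_norm p \<Omega> (\<lambda>x. \<phi> x - u n x) (\<lambda>x. G x - jacobian (u n) (at x))) \<longlonglongrightarrow> 0)"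

text \<open>Functions on the torus are functions on the whole space with period 1 in each coordinate.
  Integrals over the torus are integrals over the open unit cube.\<close>

definition Q :: "(real^'d) set" where
  "Q = {x. \<forall>i. 0 < x $ i \<and> x $ i < 1}"

definition periodic :: "(real^'d \<Rightarrow> 'b) \<Rightarrow> bool" where
  "periodic f \<longleftrightarrow> (\<forall>x i. f (x + axis i 1) = f x)"

definition C_per :: "(real^'d \<Rightarrow> 'b::topological_space) set" where
  "C_per = {f. continuous_on UNIV f \<and> periodic f}"

text \<open>The weak gradient is taken in the whole space, not just in the open cube: this excludes jumps
  of \<open>\<phi>\<close> across the faces.\<close>

definition W1p_per :: "real \<Rightarrow> (real^'d \<Rightarrow> real^'d) \<Rightarrow> (real^'d \<Rightarrow> real^'d^'d) \<Rightarrow> bool" where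
  "W1p_per p \<phi> G \<longleftrightarrow> periodic \<phi> \<and> \<phi> \<in> Lp p Q \<and> G \<in> Lp p Q \<and> weak_gradient UNIV \<phi> G"

definition V :: "real \<Rightarrow> 'b::real_normed_vector \<Rightarrow> real" where
  "V s z = sqrt (norm z powr s + (norm z)\<^sup>2)"

definition strongly_quasiconvex :: "real \<Rightarrow> real \<Rightarrow> ((real^'d^'d) \<times> real \<Rightarrow> real) \<Rightarrow> bool" where
  "strongly_quasiconvex p q e \<longleftrightarrow> (\<exists>c\<^sub>0>0. \<forall>F \<eta> \<phi> G \<psi>. W1p_per p \<phi> G \<longrightarrow> \<psi> \<in> Lp q Q \<longrightarrow>
     (LINT x|lebesgue_on Q.
        e (F + G x, \<eta> + \<psi> x) - e (F, \<eta>) - deriv_eta e (F, \<eta>) * \<psi> x)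
     \<ge> c\<^sub>0 * (LINT x|lebesgue_on Q. \<bar>V p (G x)\<bar>\<^sup>2 + \<bar>V q (\<psi> x)\<bar>\<^sup>2))"

definition rel_energy ::
  "((real^'d^'d) \<times> real \<Rightarrow> real) \<Rightarrow> (real^'d^'d) \<times> real \<Rightarrow> (real^'d^'d) \<times> real \<Rightarrow> real" where
  "rel_energy e z w =
     e z - e w - grad_F e w \<bullet> (fst z - fst w) - deriv_eta e w * (snd z - snd w)"

definition modulus_of_continuity :: "(real \<Rightarrow> real) \<Rightarrow> bool" where
  "modulus_of_continuity \<omega> \<longleftrightarrow>
     \<omega> 0 = 0 \<and> mono_on {0..} \<omega> \<and> (\<omega> \<longlongrightarrow> 0) (at_right 0)"

definition U_K ::
  "(real \<Rightarrow> real) \<Rightarrow> real \<Rightarrow> ((real^'d \<Rightarrow> real^'d^'d) \<times> (real^'d \<Rightarrow> real)) set" where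
  "U_K \<omega> K = {(F, \<eta>). F \<in> C_per \<and> \<eta> \<in> C_per \<and>
     Linf_norm Q F + Linf_norm Q \<eta> \<le> ereal K \<and>
     (\<forall>x \<in> closure Q. \<forall>y \<in> closure Q.
        norm (F x - F y) + \<bar>\<eta> x - \<eta> y\<bar> \<le> \<omega> (norm (x - y)))}"

end

theory Submission
  imports Defs
begin

text \<open>
The estimate is proved by localization to small cells on which the base state is almost constant.

Quasiconvexity with a constant base state \<open>w\<close> and a field \<open>\<phi>\<close> with zero boundary values states that the integral
of the relative energy of \<open>(\<nabla>\<phi>, \<psi>)\<close> at \<open>w\<close> dominates a multiple of the integral of the excess
\<open>\<bar>V\<^sub>p(\<nabla>\<phi>)\<bar>\<^sup>2 + \<bar>V\<^sub>q(\<psi>)\<bar>\<^sup>2\<close>. This is \<open>quasiconvexity_zero_trace\<close>: a field with zero boundary values extends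
periodically without jumps, and its gradient has integral zero. No rescaling is needed to use this for fields supported in a
small cell: such a field is also one on the unit cube, and both integrands vanish off the cell.

The relative energy of \<open>z\<close> at \<open>w\<close> is bounded by a multiple of the excess (\<open>taylor_rem_le_excess\<close>), and it changes by at most a
small multiple of the excess when \<open>w\<close> moves a little (\<open>taylor_rem_diff_le_excess\<close>); for small \<open>z\<close> both come from the
Hessian, for large \<open>z\<close> from the growth conditions. By the common modulus of continuity the base state
may therefore be frozen in each cell of a sufficiently fine grid.

It remains to cut \<open>(\<phi>, \<psi>)\<close> into pieces \<open>(\<rho>\<^sub>k \<phi>, \<rho>\<^sub>k \<psi>)\<close>, one for each cell, with \<open>\<rho>\<^sub>k = 1\<close> except in a layer along the walls of
the grid. Off the layer the sum of the relative energies of the pieces is the relative energy of \<open>(\<nabla>\<phi>, \<psi>)\<close>. In the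
layer everything is bounded by the excess, with a constant that does not depend on the layer, plus a
multiple of \<open>\<bar>V\<^sub>p(\<phi>)\<bar>\<^sup>2\<close>, whose constant does (\<open>excess_cutoff\<close>). The energies are not homogeneous, so a smooth partition of unity would not
reproduce the energy of the original pair; instead the layer is made negligible. Among \<open>m\<close> translates of the grid with essentially
disjoint layers, one carries at most the fraction \<open>d / m\<close> of the excess (\<open>layer_pigeonhole\<close>). For \<open>m\<close> large its contribution is absorbed
on the left, and only the term with \<open>\<bar>V\<^sub>p(\<phi>)\<bar>\<^sup>2\<close> is left.
\<close>

section \<open>Taylor remainders of a smooth function\<close>

lemma Ck3_partials:
  fixes e :: "'a::euclidean_space \<Rightarrow> real"
  assumes "Ck 3 e"
  shows "e differentiable (at x)"
    and "(\<lambda>x. frechet_derivative e (at x) v) differentiable (at x)"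
    and "continuous_on UNIV (\<lambda>x. frechet_derivative e (at x) v)"
    and "continuous_on UNIV (\<lambda>x. frechet_derivative (\<lambda>y. frechet_derivative e (at y) v) (at x) u)"
proof -
  have *: "Ck (Suc (Suc (Suc 0))) e" using assms by (simp add: numeral_3_eq_3)
  show "e differentiable (at x)" using * by (simp only: Ck.simps)
  have d: "\<And>v x. (\<lambda>x. frechet_derivative e (at x) v) differentiable (at x)"
    using * by (simp only: Ck.simps)
  then show "(\<lambda>x. frechet_derivative e (at x) v) differentiable (at x)" by blast
  show "continuous_on UNIV (\<lambda>x. frechet_derivative e (at x) v)"
    using d by (simp add: continuous_at_imp_continuous_on differentiable_imp_continuous_within)
  have "\<And>v u x. (\<lambda>x. frechet_derivative (\<lambda>y. frechet_derivative e (at y) v) (at x) u) differentiable (at x)"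
    using * by (simp only: Ck.simps)
  then show "continuous_on UNIV (\<lambda>x. frechet_derivative (\<lambda>y. frechet_derivative e (at y) v) (at x) u)"
    by (simp add: continuous_at_imp_continuous_on differentiable_imp_continuous_within)
qed

text \<open>The second derivative of \<open>e\<close> at \<open>x\<close> as a quadratic form, written out over the basis: the coefficients
are then functions of \<open>x\<close> alone, so uniform bounds and moduli of continuity on compact sets hold
uniformly in the direction \<open>z\<close>.\<close>

definition hess_form :: "('a::euclidean_space \<Rightarrow> real) \<Rightarrow> 'a \<Rightarrow> 'a \<Rightarrow> real" where
  "hess_form e x z = (\<Sum>i\<in>Basis. \<Sum>j\<in>Basis.
     (z \<bullet> i) * (z \<bullet> j) * frechet_derivative (\<lambda>y. frechet_derivative e (at y) i) (at x) j)"

definition taylor_rem :: "('a::euclidean_space \<Rightarrow> real) \<Rightarrow> 'a \<Rightarrow> 'a \<Rightarrow> real" where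
  "taylor_rem e w z = e (w + z) - e w - frechet_derivative e (at w) z"

lemma frechet_derivative_Basis_sum:
  fixes e :: "'a::euclidean_space \<Rightarrow> real"
  assumes "e differentiable (at x)"
  shows "frechet_derivative e (at x) z = (\<Sum>i\<in>Basis. (z \<bullet> i) * frechet_derivative e (at x) i)"
proof -
  have lin: "linear (frechet_derivative e (at x))"
    using assms linear_frechet_derivative by blast
  have "frechet_derivative e (at x) (\<Sum>i\<in>Basis. (z \<bullet> i) *\<^sub>R i) = (\<Sum>i\<in>Basis. (z \<bullet> i) * frechet_derivative e (at x) i)"
    by (simp add: linear_sum[OF lin] linear_cmul[OF lin])
  then show ?thesis by (simp add: euclidean_representation)
qed

lemma frechet_line_derivative:
  fixes e :: "'a::euclidean_space \<Rightarrow> real"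
  assumes "e differentiable (at (w + t *\<^sub>R z))"
  shows "((\<lambda>t. e (w + t *\<^sub>R z)) has_real_derivative frechet_derivative e (at (w + t *\<^sub>R z)) z) (at t)"
proof -
  have 1: "(e has_derivative frechet_derivative e (at (w + t *\<^sub>R z))) (at (w + t *\<^sub>R z))"
    using assms frechet_derivative_works by blast
  have 2: "((\<lambda>t. w + t *\<^sub>R z) has_derivative (\<lambda>h. h *\<^sub>R z)) (at t)"
    by (auto intro!: derivative_eq_intros)
  have "((\<lambda>t. e (w + t *\<^sub>R z)) has_derivative (\<lambda>h. frechet_derivative e (at (w + t *\<^sub>R z)) (h *\<^sub>R z))) (at t)"
    using has_derivative_compose[OF 2 1] .
  moreover have "(\<lambda>h. frechet_derivative e (at (w + t *\<^sub>R z)) (h *\<^sub>R z)) = (*) (frechet_derivative e (at (w + t *\<^sub>R z)) z)"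
    using linear_frechet_derivative[OF assms] by (auto simp: linear_cmul fun_eq_iff)
  ultimately show ?thesis
    by (simp add: has_field_derivative_def)
qed

lemma frechet_derivative_line_derivative:
  fixes e :: "'a::euclidean_space \<Rightarrow> real"
  assumes e: "Ck 3 e"
  shows "((\<lambda>t. frechet_derivative e (at (w + t *\<^sub>R z)) z) has_real_derivative hess_form e (w + t *\<^sub>R z) z) (at t)"
proof -
  have *: "((\<lambda>t. frechet_derivative e (at (w + t *\<^sub>R z)) i) has_real_derivative
     frechet_derivative (\<lambda>y. frechet_derivative e (at y) i) (at (w + t *\<^sub>R z)) z) (at t)" for i
    by (rule frechet_line_derivative[OF Ck3_partials(2)[OF e]])
  have "((\<lambda>t. \<Sum>i\<in>Basis. (z \<bullet> i) * frechet_derivative e (at (w + t *\<^sub>R z)) i) has_real_derivative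
     (\<Sum>i\<in>Basis. (z \<bullet> i) * frechet_derivative (\<lambda>y. frechet_derivative e (at y) i) (at (w + t *\<^sub>R z)) z)) (at t)"
    by (intro DERIV_sum DERIV_cmult *)
  moreover have "(\<Sum>i\<in>Basis. (z \<bullet> i) * frechet_derivative e (at x) i) = frechet_derivative e (at x) z" for x
    using frechet_derivative_Basis_sum[OF Ck3_partials(1)[OF e]] by metis
  moreover have "(\<Sum>i\<in>Basis. (z \<bullet> i) * frechet_derivative (\<lambda>y. frechet_derivative e (at y) i) (at x) z) = hess_form e x z" for x
    unfolding hess_form_def
    by (subst frechet_derivative_Basis_sum[OF Ck3_partials(2)[OF e]])
       (simp add: sum_distrib_left mult.assoc)
  ultimately show ?thesis by simp
qed

text \<open>Taylor's formula with Lagrange remainder along the segments, with a common intermediate point for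
both base points. The case \<open>\<beta> = 0\<close> bounds one remainder, the case \<open>\<beta> = 1\<close> compares two.\<close>

lemma taylor_rem_hess:
  fixes e :: "'a::euclidean_space \<Rightarrow> real"
  assumes e: "Ck 3 e"
  shows "\<exists>t\<in>{0..1}. taylor_rem e w z - \<beta> * taylor_rem e v z
     = (hess_form e (w + t *\<^sub>R z) z - \<beta> * hess_form e (v + t *\<^sub>R z) z) / 2"
proof -
  define f where "f t = e (w + t *\<^sub>R z) - \<beta> * e (v + t *\<^sub>R z)" for t
  define g where "g t = frechet_derivative e (at (w + t *\<^sub>R z)) z - \<beta> * frechet_derivative e (at (v + t *\<^sub>R z)) z" for t
  define h where "h t = hess_form e (w + t *\<^sub>R z) z - \<beta> * hess_form e (v + t *\<^sub>R z) z" for t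
  have fg: "(f has_real_derivative g t) (at t)" for t
    unfolding f_def g_def
    by (intro DERIV_diff DERIV_cmult frechet_line_derivative Ck3_partials(1)[OF e])
  have gh: "(g has_real_derivative h t) (at t)" for t
    unfolding g_def h_def
    by (intro DERIV_diff DERIV_cmult frechet_derivative_line_derivative e)
  define diff where "diff m = (if m = 0 then f else if m = Suc 0 then g else h)" for m :: nat
  have "\<exists>t>0. t < 1 \<and> f 1 = (\<Sum>m<2. diff m 0 / fact m * 1^m) + diff 2 t / fact 2 * 1^2"
    by (rule Maclaurin) (auto simp: diff_def less_2_cases_iff fg gh)
  then obtain t where "t > 0" "t < 1" "f 1 = f 0 + g 0 + h t / 2"
    by (auto simp: diff_def numeral_2_eq_2)
  then have "t \<in> {0..1}" "f 1 - f 0 - g 0 = h t / 2" by auto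
  then show ?thesis
    by (intro bexI[of _ t]) (auto simp: f_def g_def h_def taylor_rem_def algebra_simps)
qed

lemma hess_form_bound:
  fixes e :: "'a::euclidean_space \<Rightarrow> real"
  assumes e: "Ck 3 e" and S: "compact S"
  shows "\<exists>B\<ge>0. \<forall>x\<in>S. \<forall>z. \<bar>hess_form e x z\<bar> \<le> B * (norm z)\<^sup>2"
proof -
  define D where "D i j x = frechet_derivative (\<lambda>y. frechet_derivative e (at y) i) (at x) j" for i j x
  have "\<exists>B\<ge>0. \<forall>x\<in>S. \<bar>D i j x\<bar> \<le> B" for i j
  proof -
    have "bounded (D i j ` S)"
      using Ck3_partials(4)[OF e] S unfolding D_def
      by (intro compact_imp_bounded compact_continuous_image) (auto intro: continuous_on_subset)
    then obtain B where "\<forall>y\<in>D i j ` S. norm y \<le> B" by (auto simp: bounded_iff)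
    then show ?thesis by (intro exI[of _ "max 0 B"]) (auto simp: le_max_iff_disj)
  qed
  then obtain B where B: "\<And>i j. B i j \<ge> 0" "\<And>i j x. x \<in> S \<Longrightarrow> \<bar>D i j x\<bar> \<le> B i j"
    by metis
  have "\<bar>hess_form e x z\<bar> \<le> (\<Sum>i\<in>Basis. \<Sum>j\<in>Basis. B i j) * (norm z)\<^sup>2" if "x \<in> S" for x z
  proof -
    have "\<bar>hess_form e x z\<bar> \<le> (\<Sum>i\<in>Basis. \<Sum>j\<in>Basis. \<bar>(z \<bullet> i) * (z \<bullet> j) * D i j x\<bar>)"
      unfolding hess_form_def D_def
      by (rule order_trans[OF sum_abs]) (intro sum_mono sum_abs)
    also have "\<dots> \<le> (\<Sum>i\<in>Basis. \<Sum>j\<in>Basis. B i j * (norm z)\<^sup>2)"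
    proof (intro sum_mono)
      fix i j :: 'a assume "i \<in> Basis" "j \<in> Basis"
      then have 1: "\<bar>z \<bullet> i\<bar> * \<bar>z \<bullet> j\<bar> \<le> norm z * norm z"
        by (intro mult_mono) (auto simp: Basis_le_norm)
      have "\<bar>z \<bullet> i\<bar> * \<bar>z \<bullet> j\<bar> * \<bar>D i j x\<bar> \<le> (norm z * norm z) * B i j"
        by (rule mult_mono[OF 1]) (auto intro: B(2)[OF that])
      then show "\<bar>(z \<bullet> i) * (z \<bullet> j) * D i j x\<bar> \<le> B i j * (norm z)\<^sup>2"
        by (simp add: abs_mult power2_eq_square mult.commute)
    qed
    finally show ?thesis by (simp add: sum_distrib_right)
  qed
  then show ?thesis using B by (intro exI[of _ "\<Sum>i\<in>Basis. \<Sum>j\<in>Basis. B i j"]) (auto intro!: sum_nonneg)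
qed

lemma finite_family_uniformly_continuous:
  fixes D :: "'i \<Rightarrow> 'a::real_normed_vector \<Rightarrow> real"
  assumes "finite I" and S: "compact S" and "\<epsilon> > 0"
    and "\<And>i. i \<in> I \<Longrightarrow> continuous_on S (D i)"
  shows "\<exists>\<delta>>0. \<forall>i\<in>I. \<forall>x\<in>S. \<forall>y\<in>S. norm (x - y) < \<delta> \<longrightarrow> \<bar>D i x - D i y\<bar> \<le> \<epsilon>"
  using assms(1,4)
proof (induction I rule: finite_induct)
  case empty
  show ?case by (auto intro: exI[of _ 1])
next
  case (insert k I)
  then obtain \<delta>1 where 1: "\<delta>1 > 0"
    "\<And>i x y. i \<in> I \<Longrightarrow> x \<in> S \<Longrightarrow> y \<in> S \<Longrightarrow> norm (x - y) < \<delta>1 \<Longrightarrow> \<bar>D i x - D i y\<bar> \<le> \<epsilon>" by blast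
  have "uniformly_continuous_on S (D k)"
    using insert.prems S by (intro compact_uniformly_continuous) auto
  then obtain \<delta>2 where 2: "\<delta>2 > 0" "\<And>x x'. x \<in> S \<Longrightarrow> x' \<in> S \<Longrightarrow> dist x' x < \<delta>2 \<Longrightarrow> dist (D k x') (D k x) < \<epsilon>"
    unfolding uniformly_continuous_on_def using \<open>\<epsilon> > 0\<close> by blast
  have "\<bar>D i x - D i y\<bar> \<le> \<epsilon>"
    if "i \<in> insert k I" "x \<in> S" "y \<in> S" "norm (x - y) < min \<delta>1 \<delta>2" for i x y
  proof (cases "i = k")
    case True
    then show ?thesis using 2(2)[of y x] that by (simp add: dist_norm)
  next
    case False
    then show ?thesis using 1(2) that by auto
  qed
  then show ?case using 1(1) 2(1) by (intro exI[of _ "min \<delta>1 \<delta>2"]) auto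
qed

lemma hess_form_uniformly_continuous:
  fixes e :: "'a::euclidean_space \<Rightarrow> real"
  assumes e: "Ck 3 e" and S: "compact S" and "\<epsilon> > 0"
  shows "\<exists>\<delta>>0. \<forall>x\<in>S. \<forall>y\<in>S. norm (x - y) < \<delta> \<longrightarrow>
    (\<forall>z. \<bar>hess_form e x z - hess_form e y z\<bar> \<le> \<epsilon> * (norm z)\<^sup>2)"
proof -
  define D where "D = (\<lambda>(i, j) x. frechet_derivative (\<lambda>y. frechet_derivative e (at y) i) (at x) j)"
  define n where "n = real DIM('a)"
  have n: "n > 0" by (simp add: n_def)
  define \<epsilon>' where "\<epsilon>' = \<epsilon> / (n * n)"
  have e': "\<epsilon>' > 0" using n \<open>\<epsilon> > 0\<close> by (simp add: \<epsilon>'_def)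
  have cont: "continuous_on S (D k)" for k
    using Ck3_partials(4)[OF e] unfolding D_def by (auto simp: split_def intro: continuous_on_subset)
  obtain \<delta> where d: "\<delta> > 0" "\<And>k x y. k \<in> Basis \<times> Basis \<Longrightarrow> x \<in> S \<Longrightarrow> y \<in> S \<Longrightarrow> norm (x - y) < \<delta> \<Longrightarrow> \<bar>D k x - D k y\<bar> \<le> \<epsilon>'"
    using finite_family_uniformly_continuous[of "Basis \<times> Basis" S \<epsilon>' D, OF finite_cartesian_product[OF finite_Basis finite_Basis] S e' cont] by blast
  have "\<bar>hess_form e x z - hess_form e y z\<bar> \<le> \<epsilon> * (norm z)\<^sup>2"
    if xy: "x \<in> S" "y \<in> S" "norm (x - y) < \<delta>" for x y z
  proof -
    have "hess_form e x z - hess_form e y z = (\<Sum>i\<in>Basis. \<Sum>j\<in>Basis. (z \<bullet> i) * (z \<bullet> j) * (D (i, j) x - D (i, j) y))"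
      unfolding hess_form_def D_def by (simp add: sum_subtractf right_diff_distrib)
    then have "\<bar>hess_form e x z - hess_form e y z\<bar> \<le> (\<Sum>i\<in>Basis. \<Sum>j\<in>Basis. \<bar>(z \<bullet> i) * (z \<bullet> j) * (D (i, j) x - D (i, j) y)\<bar>)"
      by (simp only:) (rule order_trans[OF sum_abs], intro sum_mono sum_abs)
    also have "\<dots> \<le> (\<Sum>i\<in>(Basis::'a set). \<Sum>j\<in>(Basis::'a set). \<epsilon>' * (norm z)\<^sup>2)"
    proof (intro sum_mono)
      fix i j :: 'a assume ij: "i \<in> Basis" "j \<in> Basis"
      then have 1: "\<bar>z \<bullet> i\<bar> * \<bar>z \<bullet> j\<bar> \<le> norm z * norm z"
        by (intro mult_mono) (auto simp: Basis_le_norm)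
      have "\<bar>D (i, j) x - D (i, j) y\<bar> \<le> \<epsilon>'" using d(2) xy ij by simp
      then have "\<bar>z \<bullet> i\<bar> * \<bar>z \<bullet> j\<bar> * \<bar>D (i, j) x - D (i, j) y\<bar> \<le> (norm z * norm z) * \<epsilon>'"
        by (rule mult_mono[OF 1]) auto
      then show "\<bar>(z \<bullet> i) * (z \<bullet> j) * (D (i, j) x - D (i, j) y)\<bar> \<le> \<epsilon>' * (norm z)\<^sup>2"
        by (simp add: abs_mult power2_eq_square mult.commute)
    qed
    also have "\<dots> = \<epsilon> * (norm z)\<^sup>2" using n by (simp add: \<epsilon>'_def n_def[symmetric])
    finally show ?thesis .
  qed
  then show ?thesis using d(1) by blast
qed

lemma frechet_derivative_uniformly_continuous:
  fixes e :: "'a::euclidean_space \<Rightarrow> real"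
  assumes e: "Ck 3 e" and S: "compact S" and "\<epsilon> > 0"
  shows "\<exists>\<delta>>0. \<forall>x\<in>S. \<forall>y\<in>S. norm (x - y) < \<delta> \<longrightarrow>
    (\<forall>z. \<bar>frechet_derivative e (at x) z - frechet_derivative e (at y) z\<bar> \<le> \<epsilon> * norm z)"
proof -
  define D where "D = (\<lambda>i x. frechet_derivative e (at x) i)"
  define n where "n = real DIM('a)"
  have n: "n > 0" by (simp add: n_def)
  define \<epsilon>' where "\<epsilon>' = \<epsilon> / n"
  have e': "\<epsilon>' > 0" using n \<open>\<epsilon> > 0\<close> by (simp add: \<epsilon>'_def)
  have cont: "continuous_on S (D k)" for k
    using Ck3_partials(3)[OF e] unfolding D_def by (auto intro: continuous_on_subset)
  obtain \<delta> where d: "\<delta> > 0" "\<And>k x y. k \<in> Basis \<Longrightarrow> x \<in> S \<Longrightarrow> y \<in> S \<Longrightarrow> norm (x - y) < \<delta> \<Longrightarrow> \<bar>D k x - D k y\<bar> \<le> \<epsilon>'"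
    using finite_family_uniformly_continuous[of Basis S \<epsilon>' D, OF finite_Basis S e' cont] by blast
  have "\<bar>frechet_derivative e (at x) z - frechet_derivative e (at y) z\<bar> \<le> \<epsilon> * norm z"
    if xy: "x \<in> S" "y \<in> S" "norm (x - y) < \<delta>" for x y z
  proof -
    have "frechet_derivative e (at x) z - frechet_derivative e (at y) z = (\<Sum>i\<in>Basis. (z \<bullet> i) * (D i x - D i y))"
      unfolding frechet_derivative_Basis_sum[OF Ck3_partials(1)[OF e], of _ z] D_def
      by (simp add: sum_subtractf right_diff_distrib)
    then have "\<bar>frechet_derivative e (at x) z - frechet_derivative e (at y) z\<bar> \<le> (\<Sum>i\<in>Basis. \<bar>(z \<bullet> i) * (D i x - D i y)\<bar>)"
      by (simp only: sum_abs)
    also have "\<dots> \<le> (\<Sum>i\<in>(Basis::'a set). \<epsilon>' * norm z)"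
    proof (intro sum_mono)
      fix i :: 'a assume i: "i \<in> Basis"
      have "\<bar>z \<bullet> i\<bar> * \<bar>D i x - D i y\<bar> \<le> norm z * \<epsilon>'"
        using d(2)[OF i xy] Basis_le_norm[OF i, of z] by (intro mult_mono) auto
      then show "\<bar>(z \<bullet> i) * (D i x - D i y)\<bar> \<le> \<epsilon>' * norm z"
        by (simp add: abs_mult mult.commute)
    qed
    also have "\<dots> = \<epsilon> * norm z" using n by (simp add: \<epsilon>'_def n_def[symmetric])
    finally show ?thesis .
  qed
  then show ?thesis using d(1) by blast
qed

lemma taylor_rem_small:
  fixes e :: "'a::euclidean_space \<Rightarrow> real"
  assumes e: "Ck 3 e"
  shows "\<exists>C\<ge>0. \<forall>w z. norm w \<le> K \<longrightarrow> norm z \<le> 1 \<longrightarrow> \<bar>taylor_rem e w z\<bar> \<le> C * (norm z)\<^sup>2"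
proof -
  obtain B where B: "B \<ge> 0" "\<And>x z. x \<in> cball 0 (K + 1) \<Longrightarrow> \<bar>hess_form e x z\<bar> \<le> B * (norm z)\<^sup>2"
    using hess_form_bound[OF e compact_cball[of 0 "K+1"]] by blast
  have "\<bar>taylor_rem e w z\<bar> \<le> B * (norm z)\<^sup>2" if wz: "norm w \<le> K" "norm z \<le> 1" for w z
  proof -
    obtain t where t: "t \<in> {0..1}" "taylor_rem e w z - 0 * taylor_rem e 0 z
     = (hess_form e (w + t *\<^sub>R z) z - 0 * hess_form e (0 + t *\<^sub>R z) z) / 2"
      using taylor_rem_hess[OF e] by blast
    have "norm (w + t *\<^sub>R z) \<le> norm w + \<bar>t\<bar> * norm z" by (metis norm_triangle_ineq norm_scaleR)
    also have "\<dots> \<le> K + 1 * 1" using t wz by (intro add_mono mult_mono) auto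
    finally have "\<bar>hess_form e (w + t *\<^sub>R z) z\<bar> \<le> B * (norm z)\<^sup>2" by (intro B(2)) (simp only: mem_cball_0)
    moreover have "B * (norm z)\<^sup>2 \<ge> 0" using B by simp
    ultimately show ?thesis using t(2) by simp
  qed
  then show ?thesis using B(1) by blast
qed

text \<open>For small increments, moving the base point from \<open>v\<close> to \<open>w\<close> costs only an arbitrarily small multiple of
\<open>(norm z)\<^sup>2\<close>, because the two remainders differ by the oscillation of the Hessian.\<close>

lemma taylor_rem_diff_small:
  fixes e :: "'a::euclidean_space \<Rightarrow> real"
  assumes e: "Ck 3 e" and "\<epsilon> > 0"
  shows "\<exists>\<delta>>0. \<forall>w v z. norm w \<le> K \<longrightarrow> norm v \<le> K \<longrightarrow> norm (w - v) < \<delta> \<longrightarrow> norm z \<le> 1 \<longrightarrow>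
     \<bar>taylor_rem e w z - taylor_rem e v z\<bar> \<le> \<epsilon> * (norm z)\<^sup>2"
proof -
  obtain \<delta> where d: "\<delta> > 0" "\<And>x y z. x \<in> cball 0 (K + 1) \<Longrightarrow> y \<in> cball 0 (K + 1) \<Longrightarrow>
      norm (x - y) < \<delta> \<Longrightarrow> \<bar>hess_form e x z - hess_form e y z\<bar> \<le> \<epsilon> * (norm z)\<^sup>2"
    using hess_form_uniformly_continuous[OF e compact_cball[of 0 "K+1"] \<open>\<epsilon> > 0\<close>] by blast
  have "\<bar>taylor_rem e w z - taylor_rem e v z\<bar> \<le> \<epsilon> * (norm z)\<^sup>2"
    if wz: "norm w \<le> K" "norm v \<le> K" "norm (w - v) < \<delta>" "norm z \<le> 1" for w v z
  proof -
    obtain t where t: "t \<in> {0..1}" "taylor_rem e w z - 1 * taylor_rem e v z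
     = (hess_form e (w + t *\<^sub>R z) z - 1 * hess_form e (v + t *\<^sub>R z) z) / 2"
      using taylor_rem_hess[OF e] by blast
    have *: "x + t *\<^sub>R z \<in> cball 0 (K + 1)" if "norm x \<le> K" for x
    proof -
      have "norm (x + t *\<^sub>R z) \<le> norm x + \<bar>t\<bar> * norm z" by (metis norm_triangle_ineq norm_scaleR)
      also have "\<dots> \<le> K + 1 * 1" using t wz that by (intro add_mono mult_mono) auto
      finally show ?thesis by (simp only: mem_cball_0)
    qed
    have "\<bar>hess_form e (w + t *\<^sub>R z) z - hess_form e (v + t *\<^sub>R z) z\<bar> \<le> \<epsilon> * (norm z)\<^sup>2"
      using wz * by (intro d(2)) auto
    moreover have "\<epsilon> * (norm z)\<^sup>2 \<ge> 0" using \<open>\<epsilon> > 0\<close> by simp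
    ultimately show ?thesis using t(2) by simp
  qed
  then show ?thesis using d(1) by blast
qed

section \<open>Excess and relative energy\<close>

lemma V_square: "\<bar>V s z\<bar>\<^sup>2 = norm z powr s + (norm z)\<^sup>2"
  unfolding V_def by (simp add: add_nonneg_nonneg)

text \<open>The integrand on the left of the coercivity estimates. It behaves like \<open>(norm z)\<^sup>2\<close> for small \<open>z\<close> and like
\<open>norm F powr p + \<bar>\<eta>\<bar> powr q\<close> for large \<open>z = (F, \<eta>)\<close>, the two regimes in which the relative energy is estimated below.\<close>

definition excess :: "real \<Rightarrow> real \<Rightarrow> 'a::real_normed_vector \<times> real \<Rightarrow> real" where
  "excess p q z = \<bar>V p (fst z)\<bar>\<^sup>2 + \<bar>V q (snd z)\<bar>\<^sup>2"

text \<open>The natural growth of the energy and of its derivatives: all powers occurring in the growth hypotheses are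
at most \<open>p\<close> in the first component and at most \<open>q\<close> in the second.\<close>

definition growth :: "real \<Rightarrow> real \<Rightarrow> 'a::real_normed_vector \<times> real \<Rightarrow> real" where
  "growth p q z = 1 + norm (fst z) powr p + \<bar>snd z\<bar> powr q"

lemma excess_alt: "excess p q z = norm (fst z) powr p + (norm (fst z))\<^sup>2 + (\<bar>snd z\<bar> powr q + (snd z)\<^sup>2)"
  unfolding excess_def V_square by simp

lemma excess_nonneg: "0 \<le> excess p q z"
  by (simp add: excess_def)

lemma excess_0 [simp]: "excess p q 0 = 0"
  by (simp add: excess_alt)

lemma norm_square_le_excess: "(norm z)\<^sup>2 \<le> excess p q z"
proof -
  have "(norm z)\<^sup>2 = (norm (fst z))\<^sup>2 + (snd z)\<^sup>2"
    by (cases z) (simp add: norm_Pair)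
  then show ?thesis by (simp add: excess_alt)
qed

lemma powr_add_le:
  fixes a b s :: real
  assumes "0 \<le> a" "0 \<le> b" "0 \<le> s"
  shows "(a + b) powr s \<le> 2 powr s * (a powr s + b powr s)"
proof -
  have "(a + b) powr s \<le> (2 * max a b) powr s"
    using assms by (intro powr_mono2) auto
  also have "\<dots> = 2 powr s * max a b powr s"
    using assms by (intro powr_mult) 
  also have "\<dots> \<le> 2 powr s * (a powr s + b powr s)"
    by (intro mult_left_mono) (auto simp: max_def)
  finally show ?thesis .
qed

lemma powr_le_one_plus_powr:
  fixes x a b :: real
  assumes "0 \<le> x" "0 \<le> a" "a \<le> b"
  shows "x powr a \<le> 1 + x powr b"
proof (cases "x \<le> 1")
  case True
  then have "x powr a \<le> 1" using assms by (intro powr_le1) auto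
  then show ?thesis using powr_ge_zero[of x b] by linarith
next
  case False
  then have "x powr a \<le> x powr b" using assms by (intro powr_mono) auto
  then show ?thesis by simp
qed

lemma norm_fst_snd_le:
  fixes z :: "'a::real_normed_vector \<times> real"
  shows "norm (fst z) \<le> norm z" "\<bar>snd z\<bar> \<le> norm z"
  using norm_fst_le[of "fst z" "snd z"] norm_snd_le[of "snd z" "fst z"] by auto

lemma growth_nonneg: "0 \<le> growth p q z"
  by (simp add: growth_def)

lemma growth_bounded:
  assumes "norm w \<le> K" "0 \<le> p" "0 \<le> q"
  shows "growth p q w \<le> 1 + K powr p + K powr q"
  unfolding growth_def
  using norm_fst_snd_le[of w] assms by (intro add_mono powr_mono2) auto

text \<open>For increments of norm at least one, constants and the bounded base point are absorbed by the quadratic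
part of the excess, so that the growth of the energy is measured by the excess alone.\<close>

lemma growth_shift:
  assumes w: "norm w \<le> K" and z: "1 \<le> norm z" and pq: "0 \<le> p" "0 \<le> q"
  shows "growth p q (w + z) \<le> (1 + 2 powr p * (K powr p + 1) + 2 powr q * (K powr q + 1)) * excess p q z"
proof -
  have *: "(a + b) powr s \<le> 2 powr s * (K powr s + 1) * excess p q z"
    if "0 \<le> a" "a \<le> K" "0 \<le> b" "b powr s \<le> excess p q z" "0 \<le> s" for a b s
  proof -
    have E1: "1 \<le> excess p q z"
    proof -
      have "1 \<le> (norm z)\<^sup>2" using z by simp
      then show ?thesis using norm_square_le_excess[of z p q] by linarith
    qed
    have "(a + b) powr s \<le> 2 powr s * (a powr s + b powr s)"
      using that by (intro powr_add_le)
    also have "\<dots> \<le> 2 powr s * (K powr s * excess p q z + excess p q z)"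
    proof (intro mult_left_mono add_mono that)
      have "a powr s \<le> K powr s * 1" using that by (simp add: powr_mono2)
      also have "\<dots> \<le> K powr s * excess p q z" using E1 by (intro mult_left_mono) auto
      finally show "a powr s \<le> K powr s * excess p q z" .
    qed auto
    finally show ?thesis by (simp add: algebra_simps)
  qed
  have 1: "norm (fst (w + z)) powr p \<le> 2 powr p * (K powr p + 1) * excess p q z"
  proof -
    have "norm (fst (w + z)) powr p \<le> (norm (fst w) + norm (fst z)) powr p"
      using pq by (intro powr_mono2) (auto intro: norm_triangle_ineq)
    also have "\<dots> \<le> 2 powr p * (K powr p + 1) * excess p q z"
      using w pq norm_fst_snd_le[of w] by (intro *) (auto simp: excess_alt)
    finally show ?thesis .
  qed
  have 2: "\<bar>snd (w + z)\<bar> powr q \<le> 2 powr q * (K powr q + 1) * excess p q z"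
  proof -
    have "\<bar>snd (w + z)\<bar> powr q \<le> (\<bar>snd w\<bar> + \<bar>snd z\<bar>) powr q"
      using pq by (intro powr_mono2) auto
    also have "\<dots> \<le> 2 powr q * (K powr q + 1) * excess p q z"
      using w pq norm_fst_snd_le[of w] by (intro *) (auto simp: excess_alt)
    finally show ?thesis .
  qed
  have 3: "1 \<le> excess p q z"
  proof -
    have "1 \<le> (norm z)\<^sup>2" using z by simp
    then show ?thesis using norm_square_le_excess[of z p q] by linarith
  qed
  have "growth p q (w + z) \<le> excess p q z + 2 powr p * (K powr p + 1) * excess p q z + 2 powr q * (K powr q + 1) * excess p q z"
    unfolding growth_def using 1 2 3 by linarith
  then show ?thesis by (simp add: algebra_simps)
qed

definition growth_controlled :: "real \<Rightarrow> real \<Rightarrow> real \<Rightarrow> ((real^'d^'d) \<times> real \<Rightarrow> real) \<Rightarrow> bool" where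
  "growth_controlled p q A e \<longleftrightarrow> 
     (\<forall>z. \<bar>e z\<bar> \<le> A * growth p q z \<and> (\<forall>h. \<bar>frechet_derivative e (at z) h\<bar> \<le> A * growth p q z * norm h))"

lemma growth_controlledD:
  assumes "growth_controlled p q A e"
  shows "\<bar>e z\<bar> \<le> A * growth p q z" "\<bar>frechet_derivative e (at z) h\<bar> \<le> A * growth p q z * norm h"
  using assms unfolding growth_controlled_def by blast+

lemma frechet_derivative_partials:
  fixes e :: "(real^'d^'d) \<times> real \<Rightarrow> real"
  assumes "e differentiable (at z)"
  shows "frechet_derivative e (at z) (H, s) = grad_F e z \<bullet> H + deriv_eta e z * s"
proof -
  have lin: "linear (frechet_derivative e (at z))"
    using assms linear_frechet_derivative by blast
  have H: "H = (\<Sum>i\<in>UNIV. \<Sum>j\<in>UNIV. (H $ i $ j) *\<^sub>R axis i (axis j 1))"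
  proof -
    have "(\<Sum>j\<in>UNIV. H $ i $ j * axis i (axis j (1::real)) $ a $ b) = (if i = a then H $ a $ b else 0)" for i a b
      by (simp add: axis_def if_distrib cong: if_cong)
    then show ?thesis by (simp add: vec_eq_iff)
  qed
  have "(H, s) = (\<Sum>i\<in>UNIV. \<Sum>j\<in>UNIV. (H $ i $ j) *\<^sub>R (axis i (axis j 1), 0)) + s *\<^sub>R (0, 1)"
    by (subst H) (simp add: prod_eq_iff fst_sum snd_sum)
  then have "frechet_derivative e (at z) (H, s) =
     (\<Sum>i\<in>UNIV. \<Sum>j\<in>UNIV. (H $ i $ j) * frechet_derivative e (at z) (axis i (axis j 1), 0))
      + s * frechet_derivative e (at z) (0, 1)"
    by (simp only: linear_add[OF lin] linear_sum[OF lin] linear_cmul[OF lin] real_scaleR_def)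
  then show ?thesis
    by (simp add: grad_F_def deriv_eta_def inner_vec_def mult.commute)
qed

lemma growth_controlled_of_bounds:
  fixes e :: "(real^'d^'d) \<times> real \<Rightarrow> real"
  assumes p: "p \<ge> 2" and q: "q \<ge> 2" and e: "Ck 3 e"
    and c: "c > 0" "c' > 0" "\<And>F \<eta>. c * (norm F powr p + \<bar>\<eta>\<bar> powr q - 1) \<le> e (F, \<eta>) \<and>
           e (F, \<eta>) \<le> c' * (norm F powr p + \<bar>\<eta>\<bar> powr q + 1)"
    and C: "C > 0" "\<And>F \<eta>. norm (grad_F e (F, \<eta>)) \<le> C * (1 + norm F powr (p - 1) + \<bar>\<eta>\<bar> powr (q * (p - 1) / p)) \<and>
           \<bar>deriv_eta e (F, \<eta>)\<bar> \<le> C * (1 + norm F powr (p * (q - 1) / q) + \<bar>\<eta>\<bar> powr (q - 1))"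
  shows "growth_controlled p q (c + c' + 6 * C) e"
  unfolding growth_controlled_def
proof (intro allI conjI)
  fix z :: "(real^'d^'d) \<times> real"
  obtain F \<eta> where z: "z = (F, \<eta>)" by (cases z)
  define g where "g = growth p q z"
  have g: "g = 1 + norm F powr p + \<bar>\<eta>\<bar> powr q" by (simp add: g_def growth_def z)
  have g1: "g \<ge> 1" "g \<ge> 0" by (simp_all add: g)
  have "- (c * g) \<le> c * (norm F powr p + \<bar>\<eta>\<bar> powr q - 1)"
    using c(1) unfolding g by (simp add: algebra_simps)
  moreover have "0 \<le> c' * g" "0 \<le> c * g" "0 \<le> C * g" using c C g1 by auto
  moreover have "c' * (norm F powr p + \<bar>\<eta>\<bar> powr q + 1) = c' * g" by (simp add: g algebra_simps)
  ultimately show "\<bar>e z\<bar> \<le> (c + c' + 6 * C) * growth p q z"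
    using c(3)[of F \<eta>] unfolding g_def[symmetric] z[symmetric] abs_le_iff by (simp add: algebra_simps z)
  fix h :: "(real^'d^'d) \<times> real"
  have qp: "q * (p - 1) / p \<le> q" "p * (q - 1) / q \<le> p" "0 \<le> q * (p - 1) / p" "0 \<le> p * (q - 1) / q"
    using p q by (auto simp: field_simps)
  have powr: "norm F powr (p - 1) \<le> 1 + norm F powr p" "\<bar>\<eta>\<bar> powr (q * (p - 1) / p) \<le> 1 + \<bar>\<eta>\<bar> powr q"
    "\<bar>\<eta>\<bar> powr (q - 1) \<le> 1 + \<bar>\<eta>\<bar> powr q" "norm F powr (p * (q - 1) / q) \<le> 1 + norm F powr p"
    using p q qp by (intro powr_le_one_plus_powr; simp)+
  have three: "1 + a + b \<le> 3 * (1 + x + y)" if "a \<le> 1 + x" "b \<le> 1 + y" "0 \<le> x" "0 \<le> y" for a b x y :: real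
    unfolding distrib_left using that by linarith
  have nonneg: "0 \<le> norm F powr p" "0 \<le> \<bar>\<eta>\<bar> powr q" by simp_all
  have "1 + norm F powr (p - 1) + \<bar>\<eta>\<bar> powr (q * (p - 1) / p) \<le> 3 * g"
    unfolding g by (rule three[OF powr(1,2) nonneg])
  then have a: "norm (grad_F e z) \<le> C * (3 * g)"
    using C(2)[of F \<eta>] mult_left_mono[of _ "3 * g" C] C(1) unfolding z by (meson order_trans less_imp_le)
  have "1 + norm F powr (p * (q - 1) / q) + \<bar>\<eta>\<bar> powr (q - 1) \<le> 3 * g"
    unfolding g by (rule three[OF powr(4,3) nonneg])
  then have b: "\<bar>deriv_eta e z\<bar> \<le> C * (3 * g)"
    using C(2)[of F \<eta>] mult_left_mono[of _ "3 * g" C] C(1) unfolding z by (meson order_trans less_imp_le)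
  have "\<bar>frechet_derivative e (at z) (fst h, snd h)\<bar> \<le> \<bar>grad_F e z \<bullet> fst h\<bar> + \<bar>deriv_eta e z * snd h\<bar>"
    unfolding frechet_derivative_partials[OF Ck3_partials(1)[OF e]] by (rule abs_triangle_ineq)
  also have "\<dots> \<le> norm (grad_F e z) * norm (fst h) + \<bar>deriv_eta e z\<bar> * \<bar>snd h\<bar>"
    by (intro add_mono Cauchy_Schwarz_ineq2) (simp add: abs_mult)
  also have "\<dots> \<le> C * (3 * g) * norm h + C * (3 * g) * norm h"
    using a b norm_fst_snd_le[of h] C(1) g1 by (intro add_mono mult_mono) auto
  also have "\<dots> = (6 * C) * (g * norm h)" by (simp add: algebra_simps)
  also have "\<dots> \<le> (c + c' + 6 * C) * (g * norm h)"
    using c g1 by (intro mult_right_mono) auto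
  finally show "\<bar>frechet_derivative e (at z) h\<bar> \<le> (c + c' + 6 * C) * growth p q z * norm h"
    by (simp add: g_def mult.assoc)
qed

lemma one_le_excess:
  assumes "1 \<le> norm z"
  shows "1 \<le> excess p q z" "norm z \<le> excess p q z"
proof -
  have "norm z * 1 \<le> norm z * norm z" using assms by (intro mult_left_mono) auto
  then show "1 \<le> excess p q z" "norm z \<le> excess p q z"
    using norm_square_le_excess[of z p q] assms by (simp_all add: power2_eq_square)
qed

text \<open>Small increments are covered by Taylor's formula, large ones by the growth of \<open>e\<close>.\<close>

lemma taylor_rem_le_excess:
  fixes e :: "(real^'d^'d) \<times> real \<Rightarrow> real"
  assumes e: "Ck 3 e" and gr: "growth_controlled p q A e" and A: "A \<ge> 0" and pq: "0 \<le> p" "0 \<le> q"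
  shows "\<exists>C\<ge>0. \<forall>w z. norm w \<le> K \<longrightarrow> \<bar>taylor_rem e w z\<bar> \<le> C * excess p q z"
proof -
  obtain C where C: "C \<ge> 0" "\<And>w z. norm w \<le> K \<Longrightarrow> norm z \<le> 1 \<Longrightarrow> \<bar>taylor_rem e w z\<bar> \<le> C * (norm z)\<^sup>2"
    using taylor_rem_small[OF e] by blast
  define B where "B = 1 + 2 powr p * (K powr p + 1) + 2 powr q * (K powr q + 1)"
  define M where "M = 1 + K powr p + K powr q"
  have BM: "B \<ge> 0" "M \<ge> 0" by (auto simp: B_def M_def)
  have "\<bar>taylor_rem e w z\<bar> \<le> (C + A * B + 2 * (A * M)) * excess p q z" if w: "norm w \<le> K" for w z
  proof (cases "norm z \<le> 1")
    case True
    have "\<bar>taylor_rem e w z\<bar> \<le> C * (norm z)\<^sup>2" using C w True by blast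
    also have "\<dots> \<le> C * excess p q z" using C(1) by (intro mult_left_mono norm_square_le_excess)
    also have "\<dots> \<le> (C + A * B + 2 * (A * M)) * excess p q z"
      using A BM by (intro mult_right_mono excess_nonneg) auto
    finally show ?thesis .
  next
    case False
    then have z: "1 \<le> norm z" by simp
    have g: "growth p q w \<le> M" unfolding M_def using w pq by (rule growth_bounded)
    have "\<bar>e (w + z)\<bar> \<le> A * growth p q (w + z)" by (rule growth_controlledD[OF gr])
    also have "\<dots> \<le> A * (B * excess p q z)"
      unfolding B_def using w z pq A by (intro mult_left_mono growth_shift)
    finally have 1: "\<bar>e (w + z)\<bar> \<le> A * B * excess p q z" by simp
    have "\<bar>e w\<bar> \<le> A * growth p q w" by (rule growth_controlledD[OF gr])
    also have "\<dots> \<le> A * M" using g A by (intro mult_left_mono)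
    also have "\<dots> \<le> A * M * excess p q z"
      using mult_left_mono[OF one_le_excess(1)[OF z, of p q], of "A * M"] A BM by simp
    finally have 2: "\<bar>e w\<bar> \<le> A * M * excess p q z" .
    have "\<bar>frechet_derivative e (at w) z\<bar> \<le> A * growth p q w * norm z" by (rule growth_controlledD[OF gr])
    also have "\<dots> \<le> A * M * excess p q z"
      using g A one_le_excess(2)[OF z] BM growth_nonneg[of p q w] by (intro mult_mono) auto
    finally have 3: "\<bar>frechet_derivative e (at w) z\<bar> \<le> A * M * excess p q z" .
    have "0 \<le> C * excess p q z" using C(1) excess_nonneg[of p q z] by (rule mult_nonneg_nonneg)
    with 1 2 3 have "\<bar>taylor_rem e w z\<bar> \<le> C * excess p q z + A * B * excess p q z + A * M * excess p q z + A * M * excess p q z"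
      unfolding taylor_rem_def by linarith
    then show ?thesis by (simp add: algebra_simps)
  qed
  moreover have "C + A * B + 2 * (A * M) \<ge> 0" using C A BM by simp
  ultimately show ?thesis by blast
qed

text \<open>The mean value inequality on the ball of base points, the increment being fixed.\<close>

lemma energy_diff_le:
  fixes e :: "(real^'d^'d) \<times> real \<Rightarrow> real"
  assumes e: "Ck 3 e" and gr: "growth_controlled p q A e"
    and M: "\<And>w. norm w \<le> K \<Longrightarrow> growth p q (w + z) \<le> M" and "A \<ge> 0"
    and w: "norm w \<le> K" and v: "norm v \<le> K"
  shows "\<bar>e (w + z) - e (v + z)\<bar> \<le> A * M * norm (w - v)"
proof -
  have "norm (e (w + z) - e (v + z)) \<le> A * M * norm (w - v)"
  proof (rule differentiable_bound[where S = "cball 0 K" and f = "\<lambda>x. e (x + z)" and f' = "\<lambda>x. frechet_derivative e (at (x + z))"])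
    fix x :: "(real^'d^'d) \<times> real" assume x: "x \<in> cball 0 K"
    have "(e has_derivative frechet_derivative e (at (x + z))) (at (x + z))"
      using Ck3_partials(1)[OF e] frechet_derivative_works by blast
    then have "((\<lambda>x. e (x + z)) has_derivative frechet_derivative e (at (x + z))) (at x)"
      by (rule has_derivative_compose[rotated]) (auto intro!: derivative_eq_intros)
    then show "((\<lambda>x. e (x + z)) has_derivative frechet_derivative e (at (x + z))) (at x within cball 0 K)"
      by (rule has_derivative_at_withinI)
    show "onorm (frechet_derivative e (at (x + z))) \<le> A * M"
    proof (rule onorm_le)
      fix h
      have "\<bar>frechet_derivative e (at (x + z)) h\<bar> \<le> A * growth p q (x + z) * norm h"
        by (rule growth_controlledD[OF gr])
      also have "\<dots> \<le> A * M * norm h"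
        using M[of x] x \<open>A \<ge> 0\<close> by (intro mult_right_mono mult_left_mono) auto
      finally show "norm (frechet_derivative e (at (x + z)) h) \<le> A * M * norm h" by simp
    qed
  qed (use w v in auto)
  then show ?thesis by simp
qed

text \<open>Freezing the coefficients: on a set where the base state oscillates by less than \<open>\<delta>\<close>, the relative energy
may be computed with a constant base state, at the price of a small multiple of the excess. For large
increments the mean value inequality is used instead of the Hessian, since the derivative of
\<open>e\<close> at \<open>w + z\<close> has a growth which the excess controls.\<close>

lemma taylor_rem_diff_le_excess:
  fixes e :: "(real^'d^'d) \<times> real \<Rightarrow> real"
  assumes e: "Ck 3 e" and gr: "growth_controlled p q A e" and A: "A \<ge> 0" and pq: "0 \<le> p" "0 \<le> q"
    and eps: "\<epsilon> > 0"
  shows "\<exists>\<delta>>0. \<forall>w v z. norm w \<le> K \<longrightarrow> norm v \<le> K \<longrightarrow> norm (w - v) < \<delta> \<longrightarrow>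
     \<bar>taylor_rem e w z - taylor_rem e v z\<bar> \<le> \<epsilon> * excess p q z"
proof -
  obtain \<delta>1 where d1: "\<delta>1 > 0" "\<And>w v z. norm w \<le> K \<Longrightarrow> norm v \<le> K \<Longrightarrow> norm (w - v) < \<delta>1 \<Longrightarrow> norm z \<le> 1 \<Longrightarrow>
     \<bar>taylor_rem e w z - taylor_rem e v z\<bar> \<le> \<epsilon> * (norm z)\<^sup>2"
    using taylor_rem_diff_small[OF e eps, of K] by blast
  define B where "B = 1 + 2 powr p * (K powr p + 1) + 2 powr q * (K powr q + 1)"
  define M where "M = 1 + K powr p + K powr q"
  have BM: "B \<ge> 0" "M \<ge> 0" by (auto simp: B_def M_def)
  have e3: "\<epsilon> / 3 > 0" using eps by simp
  obtain \<delta>2 where d2: "\<delta>2 > 0" "\<And>x y z. x \<in> cball 0 K \<Longrightarrow> y \<in> cball 0 K \<Longrightarrow> norm (x - y) < \<delta>2 \<Longrightarrow>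
    \<bar>frechet_derivative e (at x) z - frechet_derivative e (at y) z\<bar> \<le> \<epsilon> / 3 * norm z"
    using frechet_derivative_uniformly_continuous[OF e compact_cball[of 0 K] e3] by blast
  define T where "T = 1 + A * B + A * M"
  have T: "T \<ge> 1" "A * B \<le> T" "A * M \<le> T" using A BM by (auto simp: T_def)
  define \<delta> where "\<delta> = min (min \<delta>1 \<delta>2) (\<epsilon> / 3 / T)"
  have "\<delta> > 0" using d1 d2 e3 T by (auto simp: \<delta>_def)
  moreover have "\<bar>taylor_rem e w z - taylor_rem e v z\<bar> \<le> \<epsilon> * excess p q z"
    if w: "norm w \<le> K" and v: "norm v \<le> K" and wv: "norm (w - v) < \<delta>" for w v z
  proof (cases "norm z \<le> 1")
    case True
    have "\<bar>taylor_rem e w z - taylor_rem e v z\<bar> \<le> \<epsilon> * (norm z)\<^sup>2" 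
      using w v True wv by (intro d1) (auto simp: \<delta>_def)
    also have "\<dots> \<le> \<epsilon> * excess p q z" using eps by (intro mult_left_mono norm_square_le_excess) auto
    finally show ?thesis .
  next
    case False
    then have z: "1 \<le> norm z" by simp
    have Tw: "T * norm (w - v) \<le> \<epsilon> / 3"
      using wv T(1) by (simp add: \<delta>_def field_simps)
    have "\<bar>e (w + z) - e (v + z)\<bar> \<le> A * (B * excess p q z) * norm (w - v)"
      unfolding B_def by (rule energy_diff_le[OF e gr growth_shift[OF _ z pq] A w v])
    also have "\<dots> = (A * B) * norm (w - v) * excess p q z" by simp
    also have "\<dots> \<le> \<epsilon> / 3 * excess p q z"
      using mult_right_mono[OF T(2), of "norm (w - v)"] Tw
      by (intro mult_right_mono excess_nonneg) auto
    finally have 1: "\<bar>e (w + z) - e (v + z)\<bar> \<le> \<epsilon> / 3 * excess p q z" .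
    have "\<bar>e (w + 0) - e (v + 0)\<bar> \<le> A * M * norm (w - v)"
      unfolding M_def using pq by (intro energy_diff_le[OF e gr _ A w v]) (auto intro: growth_bounded)
    also have "\<dots> \<le> \<epsilon> / 3 * 1"
      using mult_right_mono[OF T(3), of "norm (w - v)"] Tw by auto
    also have "\<dots> \<le> \<epsilon> / 3 * excess p q z" using e3 one_le_excess(1)[OF z] by (intro mult_left_mono) auto
    finally have 2: "\<bar>e w - e v\<bar> \<le> \<epsilon> / 3 * excess p q z" by simp
    have "\<bar>frechet_derivative e (at w) z - frechet_derivative e (at v) z\<bar> \<le> \<epsilon> / 3 * norm z"
      using w v wv by (intro d2) (auto simp: \<delta>_def)
    also have "\<dots> \<le> \<epsilon> / 3 * excess p q z" using e3 one_le_excess(2)[OF z] by (intro mult_left_mono) auto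
    finally show ?thesis using 1 2 unfolding taylor_rem_def by linarith
  qed
  ultimately show ?thesis by blast
qed

lemma rel_energy_eq_taylor_rem:
  fixes e :: "(real^'d^'d) \<times> real \<Rightarrow> real"
  assumes e: "Ck 3 e"
  shows "rel_energy e (w + z) w = taylor_rem e w z"
  unfolding rel_energy_def taylor_rem_def
  using frechet_derivative_partials[OF Ck3_partials(1)[OF e], of w "fst z" "snd z"] by simp

definition outer :: "real^'n \<Rightarrow> real^'m \<Rightarrow> real^'m^'n" where
  "outer a g = (\<chi> i. (a $ i) *\<^sub>R g)"

lemma norm_outer: "norm (outer a g) = norm a * norm g"
  unfolding norm_vec_def[of "outer a g"] norm_vec_def[of a]
  by (simp add: outer_def L2_set_left_distrib)

text \<open>The excess of a localized pair, whose gradient part is \<open>\<rho> \<nabla>\<phi> + \<phi> \<otimes> \<nabla>\<rho>\<close>. It is essential that the constant in front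
of the excess of the original pair does not depend on the bound \<open>L\<close> for \<open>\<nabla>\<rho>\<close>: only the lower order
term may deteriorate when the cutoff becomes steep.\<close>

lemma excess_cutoff:
  fixes G :: "real^'d^'d" and \<phi> g :: "real^'d"
  assumes p: "0 \<le> p" and q: "0 \<le> q" and \<rho>: "0 \<le> \<rho>" "\<rho> \<le> 1" and g: "norm g \<le> L"
  shows "excess p q (\<rho> *\<^sub>R G + outer \<phi> g, \<rho> * \<psi>)
     \<le> (2 + 2 powr p) * (excess p q (G, \<psi>) + (L\<^sup>2 + L powr p) * \<bar>V p \<phi>\<bar>\<^sup>2)"
proof -
  have L: "0 \<le> L" using g norm_ge_zero order_trans by blast
  define P where "P = 2 + 2 powr p"
  define \<Lambda> where "\<Lambda> = L\<^sup>2 + L powr p"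
  have P: "1 \<le> P" "2 powr p \<le> P" "2 \<le> P" by (simp_all add: P_def)
  have \<Lambda>: "L\<^sup>2 \<le> \<Lambda>" "L powr p \<le> \<Lambda>" by (simp_all add: \<Lambda>_def)
  have \<Lambda>0: "0 \<le> \<Lambda>" by (simp add: \<Lambda>_def)
  define n where "n = norm (\<rho> *\<^sub>R G + outer \<phi> g)"
  have n: "n \<le> norm G + L * norm \<phi>"
  proof -
    have "n \<le> \<rho> * norm G + norm \<phi> * norm g"
      unfolding n_def using norm_triangle_ineq[of "\<rho> *\<^sub>R G" "outer \<phi> g"] \<rho> by (simp add: norm_outer)
    also have "\<dots> \<le> 1 * norm G + norm \<phi> * L" using \<rho> g by (intro add_mono mult_right_mono mult_left_mono) auto
    finally show ?thesis by (simp add: mult.commute)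
  qed
  have "n powr p \<le> (norm G + L * norm \<phi>) powr p" using n p by (intro powr_mono2) (auto simp: n_def)
  also have "\<dots> \<le> 2 powr p * (norm G powr p + (L * norm \<phi>) powr p)" using L p by (intro powr_add_le) auto
  also have "\<dots> = 2 powr p * (norm G powr p + L powr p * norm \<phi> powr p)" using L by (simp add: powr_mult)
  also have "\<dots> \<le> P * (norm G powr p + \<Lambda> * norm \<phi> powr p)"
    using P \<Lambda> \<Lambda>0 by (intro mult_mono add_mono mult_right_mono) auto
  finally have 1: "n powr p \<le> P * (norm G powr p + \<Lambda> * norm \<phi> powr p)" .
  have "n\<^sup>2 \<le> (norm G + L * norm \<phi>)\<^sup>2" using n by (intro power_mono) (auto simp: n_def)
  also have "\<dots> \<le> 2 * ((norm G)\<^sup>2 + L\<^sup>2 * (norm \<phi>)\<^sup>2)"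
    using sum_squares_ge_zero[of "norm G - L * norm \<phi>" 0] by (simp add: power2_eq_square algebra_simps)
  also have "\<dots> \<le> P * ((norm G)\<^sup>2 + \<Lambda> * (norm \<phi>)\<^sup>2)"
    using P \<Lambda> \<Lambda>0 by (intro mult_mono add_mono mult_right_mono) auto
  finally have 2: "n\<^sup>2 \<le> P * ((norm G)\<^sup>2 + \<Lambda> * (norm \<phi>)\<^sup>2)" .
  have r\<psi>: "\<bar>\<rho> * \<psi>\<bar> \<le> \<bar>\<psi>\<bar>" using \<rho> by (simp add: abs_mult mult_left_le_one_le)
  have "\<bar>\<rho> * \<psi>\<bar> powr q \<le> 1 * \<bar>\<psi>\<bar> powr q" using r\<psi> q by (simp add: powr_mono2)
  also have "\<dots> \<le> P * \<bar>\<psi>\<bar> powr q" using P(1) by (intro mult_right_mono) auto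
  finally have 3: "\<bar>\<rho> * \<psi>\<bar> powr q \<le> P * \<bar>\<psi>\<bar> powr q" .
  have "(\<rho> * \<psi>)\<^sup>2 \<le> 1 * \<psi>\<^sup>2" using r\<psi> by (simp add: abs_le_square_iff)
  also have "\<dots> \<le> P * \<psi>\<^sup>2" using P(1) by (intro mult_right_mono) auto
  finally have 4: "(\<rho> * \<psi>)\<^sup>2 \<le> P * \<psi>\<^sup>2" .
  have "excess p q (\<rho> *\<^sub>R G + outer \<phi> g, \<rho> * \<psi>) = n powr p + n\<^sup>2 + (\<bar>\<rho> * \<psi>\<bar> powr q + (\<rho> * \<psi>)\<^sup>2)"
    by (simp add: excess_alt n_def)
  also have "\<dots> \<le> P * (norm G powr p + \<Lambda> * norm \<phi> powr p) + P * ((norm G)\<^sup>2 + \<Lambda> * (norm \<phi>)\<^sup>2) + (P * \<bar>\<psi>\<bar> powr q + P * \<psi>\<^sup>2)"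
    using 1 2 3 4 by (intro add_mono)
  also have "\<dots> = P * (excess p q (G, \<psi>) + \<Lambda> * \<bar>V p \<phi>\<bar>\<^sup>2)"
    unfolding excess_alt V_square by (simp add: algebra_simps)
  finally show ?thesis unfolding P_def \<Lambda>_def .
qed

section \<open>Integration by parts on the unit cube\<close>

lemma distr_lebesgue_translation: "distr lebesgue lebesgue (\<lambda>x::'a::euclidean_space. c + x) = lebesgue"
  and translation_lebesgue_measurable: "(\<lambda>x::'a::euclidean_space. c + x) \<in> lebesgue \<rightarrow>\<^sub>M lebesgue"
proof -
  have eq: "(\<lambda>x. c + (\<Sum>j\<in>Basis. (1 * (x \<bullet> j)) *\<^sub>R j)) = (\<lambda>x. c + x)"
    by (simp add: euclidean_representation)
  show "(\<lambda>x::'a::euclidean_space. c + x) \<in> lebesgue \<rightarrow>\<^sub>M lebesgue"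
    using lebesgue_affine_measurable[of "\<lambda>_. 1" c] unfolding eq by simp
  show "distr lebesgue lebesgue (\<lambda>x::'a::euclidean_space. c + x) = lebesgue"
    using lebesgue_affine_euclidean[of "\<lambda>_. 1" c] unfolding eq by (simp add: density_1)
qed

lemma lebesgue_integral_translation:
  fixes f :: "'a::euclidean_space \<Rightarrow> 'b::{banach, second_countable_topology}"
  assumes "integrable lebesgue f"
  shows "integrable lebesgue (\<lambda>x. f (c + x))" "(LINT x|lebesgue. f (c + x)) = (LINT x|lebesgue. f x)"
proof -
  have m: "f \<in> borel_measurable lebesgue" using assms by auto
  show "integrable lebesgue (\<lambda>x. f (c + x))"
    using integrable_distr_eq[OF translation_lebesgue_measurable m, of c] assms
    by (simp add: distr_lebesgue_translation)
  show "(LINT x|lebesgue. f (c + x)) = (LINT x|lebesgue. f x)"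
    using integral_distr[OF translation_lebesgue_measurable m, of c]
    by (simp add: distr_lebesgue_translation)
qed

lemma Q_eq_box: "Q = box 0 (vec 1)"
  by (auto simp: Q_def mem_box_cart)

lemma Q_lmeasurable: "Q \<in> lmeasurable" and Q_sets [measurable]: "Q \<in> sets lebesgue" and Q_open: "open Q"
  by (simp_all add: Q_eq_box open_box)

lemma finite_measure_Q: "finite_measure (lebesgue_on Q)"
  using Q_lmeasurable by (intro finite_measure_lebesgue_on)

lemma integrable_const_Q [simp]: "integrable (lebesgue_on Q) (\<lambda>x. c::real)"
  using finite_measure.integrable_const[OF finite_measure_Q] .

lemma continuous_bounded_on_Q:
  fixes f :: "real^'d \<Rightarrow> 'b::real_normed_vector"
  assumes "continuous_on UNIV f"
  shows "\<exists>M\<ge>0. \<forall>x\<in>Q. norm (f x) \<le> M"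
proof -
  have "bounded (f ` cbox 0 (vec 1))"
    using assms by (intro compact_imp_bounded compact_continuous_image) (auto intro: continuous_on_subset)
  then obtain M where "\<forall>y\<in>f ` cbox 0 (vec 1). norm y \<le> M" by (auto simp: bounded_iff)
  moreover have "Q \<subseteq> cbox 0 (vec 1 :: real^'d)" by (simp add: Q_eq_box box_subset_cbox)
  ultimately show ?thesis by (intro exI[of _ "max M 0"]) (auto simp: le_max_iff_disj)
qed

lemma continuous_measurable_Q:
  fixes f :: "real^'d \<Rightarrow> 'b::euclidean_space"
  assumes "continuous_on UNIV f"
  shows "f \<in> borel_measurable (lebesgue_on Q)"
  using assms Q_sets by (intro continuous_imp_measurable_on_sets_lebesgue) (auto intro: continuous_on_subset)

lemma integrable_mult_continuous_Q:
  fixes f c :: "real^'d \<Rightarrow> real"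
  assumes f: "integrable (lebesgue_on Q) f" and c: "continuous_on UNIV c"
  shows "integrable (lebesgue_on Q) (\<lambda>x. f x * c x)"
proof -
  obtain M where M: "M \<ge> 0" "\<And>x. x \<in> Q \<Longrightarrow> \<bar>c x\<bar> \<le> M"
    using continuous_bounded_on_Q[OF c] by auto
  show ?thesis
  proof (rule Bochner_Integration.integrable_bound)
    show "integrable (lebesgue_on Q) (\<lambda>x. M * f x)" using f by simp
    show "(\<lambda>x. f x * c x) \<in> borel_measurable (lebesgue_on Q)"
      using f continuous_measurable_Q[OF c] by (intro borel_measurable_times) auto
    show "AE x in lebesgue_on Q. norm (f x * c x) \<le> norm (M * f x)"
      using M by (intro AE_I2) (auto simp: abs_mult mult.commute[of M] intro!: mult_left_mono)
  qed
qed

lemma integrable_continuous_Q: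
  fixes c :: "real^'d \<Rightarrow> real"
  assumes c: "continuous_on UNIV c"
  shows "integrable (lebesgue_on Q) c"
  using integrable_mult_continuous_Q[OF integrable_const_Q c, of 1] by simp

text \<open>Only derivatives in one coordinate direction enter an integration by parts, so this is the regularity
that is asked of the multipliers. Products and cutoffs built from functions of one variable have it by the
one-dimensional rules.\<close>

definition C1_along :: "'d \<Rightarrow> (real^'d \<Rightarrow> real) \<Rightarrow> (real^'d \<Rightarrow> real) \<Rightarrow> bool" where
  "C1_along j \<zeta> g \<longleftrightarrow> continuous_on UNIV \<zeta> \<and> continuous_on UNIV g \<and>
     (\<forall>x. ((\<lambda>t. \<zeta> (x + t *\<^sub>R axis j 1)) has_real_derivative g x) (at 0))"

lemma C1_along_mult:
  assumes "C1_along j f f'" "C1_along j g g'"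
  shows "C1_along j (\<lambda>x. f x * g x) (\<lambda>x. f x * g' x + f' x * g x)"
  unfolding C1_along_def
proof (intro conjI allI)
  fix x
  have "((\<lambda>t. f (x + t *\<^sub>R axis j 1) * g (x + t *\<^sub>R axis j 1)) has_real_derivative
     f' x * g (x + 0 *\<^sub>R axis j 1) + g' x * f (x + 0 *\<^sub>R axis j 1)) (at 0)"
    using assms unfolding C1_along_def by (intro DERIV_mult) auto
  then show "((\<lambda>t. f (x + t *\<^sub>R axis j 1) * g (x + t *\<^sub>R axis j 1)) has_real_derivative
     f x * g' x + f' x * g x) (at 0)"
    by (simp add: algebra_simps)
qed (use assms in \<open>auto simp: C1_along_def intro!: continuous_intros\<close>)

lemma C1_along_DERIV:
  assumes "C1_along j f g"
  shows "((\<lambda>t. f (x + t *\<^sub>R axis j 1)) has_real_derivative g (x + t *\<^sub>R axis j 1)) (at t)"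
proof -
  have "((\<lambda>s. f ((x + t *\<^sub>R axis j 1) + s *\<^sub>R axis j 1)) has_real_derivative g (x + t *\<^sub>R axis j 1)) (at 0)"
    using assms unfolding C1_along_def by blast
  then have "((\<lambda>s. f (x + (s + t) *\<^sub>R axis j 1)) has_real_derivative g (x + t *\<^sub>R axis j 1)) (at 0)"
    by (simp add: algebra_simps)
  then show ?thesis using DERIV_shift[of "\<lambda>s. f (x + s *\<^sub>R axis j 1)" "g (x + t *\<^sub>R axis j 1)" 0 t] by simp
qed

lemma C1_along_eq_0:
  assumes "C1_along j f g" "open S" "x \<in> S" "\<And>y. y \<in> S \<Longrightarrow> f y = 0"
  shows "g x = 0"
proof -
  have 1: "((\<lambda>t. f (x + t *\<^sub>R axis j 1)) has_real_derivative g x) (at 0)"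
    using assms by (simp add: C1_along_def)
  have "((\<lambda>t. x + t *\<^sub>R axis j (1::real)) \<longlongrightarrow> x + 0 *\<^sub>R axis j 1) (nhds 0)"
    by (intro tendsto_intros filterlim_ident)
  then have "((\<lambda>t. x + t *\<^sub>R axis j (1::real)) \<longlongrightarrow> x) (nhds 0)" by simp
  then have "\<forall>\<^sub>F t in nhds 0. x + t *\<^sub>R axis j 1 \<in> S"
    using assms(2,3) by (rule topological_tendstoD)
  then have "\<forall>\<^sub>F t in nhds 0. f (x + t *\<^sub>R axis j 1) = 0"
    by eventually_elim (rule assms(4))
  then have "((\<lambda>t. 0) has_real_derivative g x) (at 0)"
    using 1 DERIV_cong_ev[of 0 0 "\<lambda>t. f (x + t *\<^sub>R axis j 1)" "\<lambda>t. 0" "g x" "g x"] by simp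
  then show ?thesis using DERIV_const DERIV_unique by blast
qed

lemma integrable_continuous_bounded_support:
  fixes f :: "real^'d \<Rightarrow> real"
  assumes "continuous_on UNIV f" "\<And>x. norm x > R \<Longrightarrow> f x = 0"
  shows "integrable lebesgue f"
proof -
  have "integrable lborel (\<lambda>x. indicator (cball 0 R) x *\<^sub>R f x)"
    using assms(1) by (intro borel_integrable_compact) (auto intro: continuous_on_subset)
  moreover have "(\<lambda>x. indicator (cball 0 R) x *\<^sub>R f x) = f"
    using assms(2) by (auto simp: indicator_def fun_eq_iff not_le)
  ultimately have "integrable lborel f" by simp
  then show ?thesis by (simp add: integrable_completion)
qed

text \<open>The integrals of the difference quotients vanish by translation invariance, and the quotients
converge to the derivative under a common bound.\<close>

lemma integral_partial_derivative_eq_0: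
  fixes f g :: "real^'d \<Rightarrow> real"
  assumes fg: "C1_along j f g" and supp: "\<And>x. norm x > R \<Longrightarrow> f x = 0" and R: "R \<ge> 0"
  shows "(LINT x|lebesgue. g x) = 0"
proof -
  define a where "a = (axis j 1 :: real^'d)"
  have na: "norm a = 1" by (simp add: a_def)
  have cont: "continuous_on UNIV f" "continuous_on UNIV g" using fg by (auto simp: C1_along_def)
  have suppg: "g x = 0" if "norm x > R" for x
    using C1_along_eq_0[OF fg, of "- cball 0 R" x] supp that by auto
  obtain M where M: "M \<ge> 0" "\<And>x. \<bar>g x\<bar> \<le> M"
  proof -
    have "bounded (g ` cball 0 R)"
      using cont by (intro compact_imp_bounded compact_continuous_image) (auto intro: continuous_on_subset)
    then obtain M where M: "\<forall>y\<in>g ` cball 0 R. norm y \<le> M" by (auto simp: bounded_iff)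
    have "\<bar>g x\<bar> \<le> max M 0" for x
      using M suppg[of x] by (cases "norm x > R") (auto simp: le_max_iff_disj)
    then show ?thesis using that[of "max M 0"] by auto
  qed
  have diff: "\<bar>f (x + h *\<^sub>R a) - f x\<bar> \<le> h * M" if "h > 0" for x h
  proof -
    have "\<exists>z>0. z < h \<and> f (x + h *\<^sub>R a) - f (x + 0 *\<^sub>R a) = (h - 0) * g (x + z *\<^sub>R a)"
      by (rule MVT2[OF that]) (simp add: C1_along_DERIV[OF fg] a_def)
    then obtain z where "f (x + h *\<^sub>R a) - f (x + 0 *\<^sub>R a) = (h - 0) * g (x + z *\<^sub>R a)"
      by blast
    then show ?thesis using that M(2)[of "x + z *\<^sub>R a"] by (simp add: abs_mult)
  qed
  have fint: "integrable lebesgue f" "integrable lebesgue (\<lambda>x. f (c + x))" for c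
    using integrable_continuous_bounded_support[OF cont(1) supp] lebesgue_integral_translation(1) by auto
  define h where "h n = 1 / real (Suc n)" for n
  have h: "h n > 0" "h n \<le> 1" for n by (auto simp: h_def)
  define s where "s n x = (f (h n *\<^sub>R a + x) - f x) / h n" for n x
  have s0: "(LINT x|lebesgue. s n x) = 0" for n
    using lebesgue_integral_translation(2)[OF fint(1), of "h n *\<^sub>R a"] fint
    by (simp add: s_def)
  \<comment> \<open>The quotients vanish outside the ball of radius \<open>R + 1\<close>, because the steps \<open>h n\<close> are at most one.\<close>
  have "(\<lambda>n. LINT x|lebesgue. s n x) \<longlonglongrightarrow> (LINT x|lebesgue. g x)"
  proof (rule integral_dominated_convergence)
    show "g \<in> borel_measurable lebesgue" 
      using integrable_continuous_bounded_support[OF cont(2) suppg] by auto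
    show "s n \<in> borel_measurable lebesgue" for n
      unfolding s_def using fint by (intro borel_measurable_divide borel_measurable_diff) auto
    show "integrable lebesgue (\<lambda>x. M * indicator (cball (0::real^'d) (R + 1)) x)"
      using lmeasurable_cball[of "0::real^'d" "R + 1"] by (intro integrable_mult_right) (simp add: lmeasurable_iff_integrable)
    show "AE x in lebesgue. (\<lambda>n. s n x) \<longlonglongrightarrow> g x"
    proof (rule AE_I2)
      fix x
      have "((\<lambda>t. (f (x + (0 + t) *\<^sub>R a) - f (x + 0 *\<^sub>R a)) / t) \<longlongrightarrow> g x) (at 0)"
        using fg unfolding C1_along_def a_def DERIV_def by blast
      moreover have "filterlim h (at 0) sequentially"
      proof -
        have "h = (\<lambda>n. inverse (real (Suc n)))" by (simp add: h_def fun_eq_iff inverse_eq_divide)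
        then have "h \<longlonglongrightarrow> 0" using LIMSEQ_inverse_real_of_nat by simp
        then show ?thesis unfolding filterlim_at using h(1) by (auto simp: less_imp_neq[symmetric])
      qed
      ultimately have "(\<lambda>n. (f (x + (0 + h n) *\<^sub>R a) - f (x + 0 *\<^sub>R a)) / h n) \<longlonglongrightarrow> g x"
        by (rule filterlim_compose)
      then show "(\<lambda>n. s n x) \<longlonglongrightarrow> g x" by (simp add: s_def add.commute)
    qed
    show "AE x in lebesgue. norm (s n x) \<le> M * indicator (cball (0::real^'d) (R + 1)) x" for n
    proof (rule AE_I2)
      fix x
      show "norm (s n x) \<le> M * indicator (cball (0::real^'d) (R + 1)) x"
      proof (cases "norm x \<le> R + 1")
        case True
        then show ?thesis using diff[OF h(1), of x n] h(1)[of n]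
          by (simp add: s_def add.commute pos_divide_le_eq mult.commute)
      next
        case False
        have "norm x \<le> norm (h n *\<^sub>R a + x) + norm (h n *\<^sub>R a)"
          using norm_triangle_ineq4[of "h n *\<^sub>R a + x" "h n *\<^sub>R a"] by simp
        then have "norm (h n *\<^sub>R a + x) > R" "norm x > R" using False h[of n] na by auto
        then show ?thesis using False by (simp add: s_def supp)
      qed
    qed
  qed
  then show ?thesis using s0 by (simp add: LIMSEQ_const_iff)
qed

lemma frechet_derivative_along_axis:
  fixes u :: "real^'d \<Rightarrow> 'b::real_normed_vector"
  assumes "u differentiable (at x)"
  shows "((\<lambda>t. u (x + t *\<^sub>R axis j 1)) has_vector_derivative frechet_derivative u (at x) (axis j 1)) (at 0)"
proof -
  have 1: "(u has_derivative frechet_derivative u (at x)) (at (x + 0 *\<^sub>R axis j 1))"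
    using assms frechet_derivative_works by auto
  have 2: "((\<lambda>t. x + t *\<^sub>R axis j (1::real)) has_derivative (\<lambda>h. h *\<^sub>R axis j 1)) (at 0)"
    by (auto intro!: derivative_eq_intros)
  have "((\<lambda>t. u (x + t *\<^sub>R axis j 1)) has_derivative (\<lambda>h. frechet_derivative u (at x) (h *\<^sub>R axis j 1))) (at 0)"
    using has_derivative_compose[OF 2 1] .
  then show ?thesis
    using linear_frechet_derivative[OF assms] by (simp add: has_vector_derivative_def linear_cmul)
qed

lemma test_function_differentiable:
  assumes "test_function \<Omega> u"
  shows "u differentiable (at x)" "continuous_on UNIV u" "continuous_on UNIV (\<lambda>x. frechet_derivative u (at x) v)"
proof -
  have "Ck (Suc 0) u" using assms unfolding test_function_def by blast
  then have *: "\<And>x. u differentiable (at x)" "\<And>v. continuous_on UNIV (\<lambda>x. frechet_derivative u (at x) v)" 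
    by simp_all
  show "u differentiable (at x)" "continuous_on UNIV (\<lambda>x. frechet_derivative u (at x) v)" by (rule *)+
  show "continuous_on UNIV u"
    using * by (simp add: continuous_at_imp_continuous_on differentiable_imp_continuous_within)
qed

lemma C1_along_test_function:
  assumes "test_function \<Omega> \<zeta>"
  shows "C1_along j \<zeta> (\<lambda>x. frechet_derivative \<zeta> (at x) (axis j 1))"
  unfolding C1_along_def
  using test_function_differentiable[OF assms] frechet_derivative_along_axis[OF test_function_differentiable(1)[OF assms]]
  by (auto simp: has_real_derivative_iff_has_vector_derivative)

lemma C1_along_test_function_component:
  fixes u :: "real^'d \<Rightarrow> real^'d"
  assumes "test_function \<Omega> u"
  shows "C1_along j (\<lambda>x. u x $ i) (\<lambda>x. jacobian u (at x) $ i $ j)"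
proof -
  have eq: "jacobian u (at x) $ i $ j = frechet_derivative u (at x) (axis j 1) $ i" for x
    by (simp add: jacobian_def matrix_def)
  have "((\<lambda>t. u (x + t *\<^sub>R axis j 1) $ i) has_vector_derivative frechet_derivative u (at x) (axis j 1) $ i) (at 0)" for x
    using bounded_linear.has_vector_derivative[OF bounded_linear_vec_nth
        frechet_derivative_along_axis[OF test_function_differentiable(1)[OF assms]]] .
  then show ?thesis
    unfolding C1_along_def eq has_real_derivative_iff_has_vector_derivative
    using test_function_differentiable[OF assms] by (auto intro!: continuous_intros)
qed

lemma test_function_eq_0:
  fixes u :: "real^'d \<Rightarrow> real^'d"
  assumes u: "test_function \<Omega> u" and x: "x \<notin> \<Omega>"
  shows "u x = 0" "jacobian u (at x) $ i $ j = 0"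
proof -
  define S where "S = - closure {x. u x \<noteq> 0}"
  have S: "open S" "x \<in> S" "\<And>y. y \<in> S \<Longrightarrow> u y = 0"
    using u x closure_subset[of "{x. u x \<noteq> 0}"] by (auto simp: S_def test_function_def)
  show "u x = 0" using S by blast
  show "jacobian u (at x) $ i $ j = 0"
    by (rule C1_along_eq_0[OF C1_along_test_function_component[OF u] S(1,2)]) (simp add: S(3))
qed

text \<open>The multiplier \<open>\<zeta>\<close> need not vanish on the boundary of the cube, since \<open>u\<close> does.\<close>

lemma test_function_integration_by_parts:
  fixes u :: "real^'d \<Rightarrow> real^'d"
  assumes u: "test_function Q u" and \<zeta>: "C1_along j \<zeta> g"
  shows "(LINT x|lebesgue_on Q. u x $ i * g x) = - (LINT x|lebesgue_on Q. jacobian u (at x) $ i $ j * \<zeta> x)"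
proof -
  define Du where "Du x = jacobian u (at x) $ i $ j" for x
  have c1: "C1_along j (\<lambda>x. u x $ i) Du"
    unfolding Du_def by (rule C1_along_test_function_component[OF u])
  have cont: "continuous_on UNIV Du" "continuous_on UNIV \<zeta>" "continuous_on UNIV g" "continuous_on UNIV (\<lambda>x. u x $ i)"
    using c1 \<zeta> by (auto simp: C1_along_def)
  obtain R where R: "R \<ge> 0" "\<And>x. x \<in> Q \<Longrightarrow> norm (x::real^'d) \<le> R"
    using continuous_bounded_on_Q[OF continuous_on_id] by auto
  have 0: "u x = 0" "Du x = 0" if "x \<notin> Q" for x
    using test_function_eq_0[OF u that] by (auto simp: Du_def)
  have out: "u x $ i = 0" "Du x = 0" if "norm x > R" for x
  proof -
    have "x \<notin> Q" using R(2)[of x] that by auto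
    then show "u x $ i = 0" "Du x = 0" by (simp_all add: 0)
  qed
  have *: "(LINT x|lebesgue_on Q. f x) = (LINT x|lebesgue. f x)" if "\<And>x. x \<notin> Q \<Longrightarrow> f x = 0" for f :: "real^'d \<Rightarrow> real"
  proof -
    have "(\<lambda>x. indicator Q x *\<^sub>R f x) = f" using that by (auto simp: indicator_def fun_eq_iff)
    then show ?thesis by (simp add: integral_restrict_space)
  qed
  have "(LINT x|lebesgue. u x $ i * g x + Du x * \<zeta> x) = 0"
    by (rule integral_partial_derivative_eq_0[OF C1_along_mult[OF c1 \<zeta>] _ R(1)]) (simp add: out)
  moreover have "integrable lebesgue (\<lambda>x. u x $ i * g x)" "integrable lebesgue (\<lambda>x. Du x * \<zeta> x)"
    using cont out by (auto intro!: integrable_continuous_bounded_support[where R=R] continuous_intros)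
  ultimately have "(LINT x|lebesgue. u x $ i * g x) = - (LINT x|lebesgue. Du x * \<zeta> x)" by simp
  then show ?thesis using 0 by (simp add: * Du_def)
qed

section \<open>Fields with zero boundary values\<close>

lemma Lp_measurable: "f \<in> Lp s Q \<Longrightarrow> f \<in> borel_measurable (lebesgue_on Q)"
  by (simp add: Lp_def)

lemma Lp_integrable_powr:
  fixes f :: "real^'d \<Rightarrow> 'b::euclidean_space"
  assumes f: "f \<in> Lp s Q" and "0 \<le> r" "r \<le> s"
  shows "integrable (lebesgue_on Q) (\<lambda>x. norm (f x) powr r)"
proof (rule Bochner_Integration.integrable_bound)
  show "integrable (lebesgue_on Q) (\<lambda>x. 1 + norm (f x) powr s)"
    using f by (intro Bochner_Integration.integrable_add) (auto simp: Lp_def)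
  show "(\<lambda>x. norm (f x) powr r) \<in> borel_measurable (lebesgue_on Q)"
    using Lp_measurable[OF f] by measurable
  show "AE x in lebesgue_on Q. norm (norm (f x) powr r) \<le> norm (1 + norm (f x) powr s)"
    using powr_le_one_plus_powr[of "norm (f _)" r s] assms(2,3) by (intro AE_I2) auto
qed

lemma Lp_integrable_norm:
  fixes f :: "real^'d \<Rightarrow> 'b::euclidean_space"
  assumes f: "f \<in> Lp s Q" and s: "1 \<le> s"
  shows "integrable (lebesgue_on Q) (\<lambda>x. norm (f x))" "integrable (lebesgue_on Q) f"
proof -
  show 1: "integrable (lebesgue_on Q) (\<lambda>x. norm (f x))"
    using Lp_integrable_powr[OF f, of 1] s by simp
  then show "integrable (lebesgue_on Q) f"
    using integrable_norm_cancel[OF _ Lp_measurable[OF f]] by blast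
qed

lemma Lp_integrable_V:
  fixes f :: "real^'d \<Rightarrow> 'b::euclidean_space"
  assumes f: "f \<in> Lp s Q" and s: "2 \<le> s"
  shows "integrable (lebesgue_on Q) (\<lambda>x. \<bar>V s (f x)\<bar>\<^sup>2)"
proof -
  have "norm y powr 2 = (norm y)\<^sup>2" for y :: 'b by (cases "y = 0") auto
  then have "integrable (lebesgue_on Q) (\<lambda>x. (norm (f x))\<^sup>2)"
    using Lp_integrable_powr[OF f, of 2] s by simp
  then show ?thesis
    unfolding V_square using Lp_integrable_powr[OF f, of s] s by (intro Bochner_Integration.integrable_add) auto
qed

lemma Lp_add:
  fixes f g :: "real^'d \<Rightarrow> 'b::euclidean_space"
  assumes f: "f \<in> Lp s Q" and g: "g \<in> Lp s Q" and s: "0 \<le> s"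
  shows "(\<lambda>x. f x + g x) \<in> Lp s Q"
  unfolding Lp_def
proof (intro CollectI conjI)
  show "(\<lambda>x. f x + g x) \<in> borel_measurable (lebesgue_on Q)"
    using f g by (auto simp: Lp_def)
  show "integrable (lebesgue_on Q) (\<lambda>x. norm (f x + g x) powr s)"
  proof (rule Bochner_Integration.integrable_bound)
    show "integrable (lebesgue_on Q) (\<lambda>x. 2 powr s * (norm (f x) powr s + norm (g x) powr s))"
      using f g by (auto simp: Lp_def)
    show "(\<lambda>x. norm (f x + g x) powr s) \<in> borel_measurable (lebesgue_on Q)"
      using Lp_measurable[OF f] Lp_measurable[OF g] by measurable
    show "AE x in lebesgue_on Q. norm (norm (f x + g x) powr s) \<le> norm (2 powr s * (norm (f x) powr s + norm (g x) powr s))"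
    proof (rule AE_I2)
      fix x
      have "norm (f x + g x) powr s \<le> (norm (f x) + norm (g x)) powr s"
        using s by (intro powr_mono2) (auto intro: norm_triangle_ineq)
      also have "\<dots> \<le> 2 powr s * (norm (f x) powr s + norm (g x) powr s)"
        using s by (intro powr_add_le) auto
      finally show "norm (norm (f x + g x) powr s) \<le> norm (2 powr s * (norm (f x) powr s + norm (g x) powr s))"
        by simp
    qed
  qed
qed

lemma Lp_dominated:
  fixes f :: "real^'d \<Rightarrow> 'b::euclidean_space" and g :: "real^'d \<Rightarrow> 'c::euclidean_space"
  assumes f: "f \<in> Lp s Q" and g: "g \<in> borel_measurable (lebesgue_on Q)"
    and le: "\<And>x. x \<in> Q \<Longrightarrow> norm (g x) \<le> M * norm (f x)" and M: "0 \<le> M" and s: "0 \<le> s"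
  shows "g \<in> Lp s Q"
  unfolding Lp_def
proof (intro CollectI conjI g)
  show "integrable (lebesgue_on Q) (\<lambda>x. norm (g x) powr s)"
  proof (rule Bochner_Integration.integrable_bound)
    show "integrable (lebesgue_on Q) (\<lambda>x. M powr s * norm (f x) powr s)"
      using f by (auto simp: Lp_def)
    show "(\<lambda>x. norm (g x) powr s) \<in> borel_measurable (lebesgue_on Q)"
      using g by measurable
    show "AE x in lebesgue_on Q. norm (norm (g x) powr s) \<le> norm (M powr s * norm (f x) powr s)"
    proof (rule AE_I2)
      fix x :: "real^'d" assume "x \<in> space (lebesgue_on Q)"
      then have "norm (g x) powr s \<le> (M * norm (f x)) powr s"
        using le s by (intro powr_mono2) auto
      then show "norm (norm (g x) powr s) \<le> norm (M powr s * norm (f x) powr s)"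
        using M by (simp add: powr_mult)
    qed
  qed
qed

lemma continuous_in_Lp:
  fixes f :: "real^'d \<Rightarrow> 'b::euclidean_space"
  assumes f: "continuous_on UNIV f" and s: "0 \<le> s"
  shows "f \<in> Lp s Q"
proof -
  obtain M where M: "M \<ge> 0" "\<And>x. x \<in> Q \<Longrightarrow> norm (f x) \<le> M"
    using continuous_bounded_on_Q[OF f] by auto
  have one: "(\<lambda>x. 1::real) \<in> Lp s (Q :: (real^'d) set)" by (simp add: Lp_def)
  show ?thesis
    by (rule Lp_dominated[OF one continuous_measurable_Q[OF f] _ M(1) s]) (simp add: M(2))
qed

text \<open>The weak formulation of ``\<open>G\<close> is the gradient of \<open>\<phi>\<close> and \<open>\<phi>\<close> vanishes on the boundary of \<open>Q\<close>'': the
integration by parts has no boundary term, even for multipliers that do not vanish there. This form is stable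
under cutoffs (put \<open>\<rho> \<zeta>\<close> for \<open>\<zeta>\<close>) and says directly that the periodic extension has no
jumps across the faces.\<close>

definition zero_trace_gradient :: "(real^'d \<Rightarrow> real^'d) \<Rightarrow> (real^'d \<Rightarrow> real^'d^'d) \<Rightarrow> bool" where
  "zero_trace_gradient \<phi> G \<longleftrightarrow> (\<forall>\<zeta> g i j. C1_along j \<zeta> g \<longrightarrow>
     (LINT x|lebesgue_on Q. \<phi> x $ i * g x) = - (LINT x|lebesgue_on Q. G x $ i $ j * \<zeta> x))"

text \<open>Used instead of Hoelder's inequality to pass from convergence in \<open>L\<^sup>p\<close> to convergence of integrals.\<close>

lemma le_eps_plus_powr:
  fixes a :: real
  assumes "0 \<le> a" "0 < \<epsilon>" "1 \<le> p"
  shows "a \<le> \<epsilon> + \<epsilon> powr (1 - p) * a powr p"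
proof (cases "a \<le> \<epsilon>")
  case True
  then show ?thesis by (simp add: add_increasing2)
next
  case False
  then have "a powr (1 - p) \<le> \<epsilon> powr (1 - p)"
    using assms by (intro powr_mono2') auto
  then have "a powr (1 - p) * a powr p \<le> \<epsilon> powr (1 - p) * a powr p"
    by (intro mult_right_mono) auto
  moreover have "a powr (1 - p) * a powr p = a"
    using False assms by (simp add: powr_add[symmetric])
  ultimately show ?thesis using assms by simp
qed

lemma component_integrable:
  fixes \<phi> :: "real^'d \<Rightarrow> real^'d" and G :: "real^'d \<Rightarrow> real^'d^'d"
  shows "integrable M \<phi> \<Longrightarrow> integrable M (\<lambda>x. \<phi> x $ i)" "integrable M G \<Longrightarrow> integrable M (\<lambda>x. G x $ i $ j)"
proof -
  show "integrable M \<phi> \<Longrightarrow> integrable M (\<lambda>x. \<phi> x $ i)"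
    using bounded_linear_vec_nth integrable_bounded_linear by blast
  show "integrable M G \<Longrightarrow> integrable M (\<lambda>x. G x $ i $ j)"
    using integrable_bounded_linear[OF bounded_linear_compose[OF bounded_linear_vec_nth bounded_linear_vec_nth]] by blast
qed

text \<open>The identity holds for test functions, and both sides pass to the limit along the approximating sequence.\<close>

lemma W1p0_zero_trace_gradient:
  fixes \<phi> :: "real^'d \<Rightarrow> real^'d"
  assumes W: "W1p0 p Q \<phi> G" and p: "1 \<le> p"
  shows "zero_trace_gradient \<phi> G"
  unfolding zero_trace_gradient_def
proof (intro allI impI)
  fix \<zeta> g :: "real^'d \<Rightarrow> real" and i j assume \<zeta>: "C1_along j \<zeta> g"
  have \<phi>: "\<phi> \<in> Lp p Q" and G: "G \<in> Lp p Q" using W by (auto simp: W1p0_def W1p_def)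
  obtain u :: "nat \<Rightarrow> real^'d \<Rightarrow> real^'d" where u: "\<And>n. test_function Q (u n)"
    and lim: "(\<lambda>n. W1p_norm p Q (\<lambda>x. \<phi> x - u n x) (\<lambda>x. G x - jacobian (u n) (at x))) \<longlonglongrightarrow> 0"
    using W unfolding W1p0_def by blast
  define a where "a n x = \<phi> x - u n x" for n x
  define b where "b n x = G x - jacobian (u n) (at x)" for n x
  have cu: "continuous_on UNIV (u n)" for n
    using test_function_differentiable(2)[OF u] .
  have cDu: "continuous_on UNIV (\<lambda>x. jacobian (u n) (at x))" for n
  proof -
    have "continuous_on UNIV (\<lambda>x. \<chi> k l. jacobian (u n) (at x) $ k $ l)"
      using C1_along_test_function_component[OF u] by (intro continuous_on_vec_lambda) (simp add: C1_along_def)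
    then show ?thesis by (simp add: vec_eq_iff)
  qed
  have a: "a n \<in> Lp p Q" for n
    unfolding a_def using Lp_add[OF \<phi> continuous_in_Lp[OF continuous_on_minus[OF cu]], of n] p by simp
  have b: "b n \<in> Lp p Q" for n
    unfolding b_def using Lp_add[OF G continuous_in_Lp[OF continuous_on_minus[OF cDu]], of n] p by simp
  have c: "continuous_on UNIV \<zeta>" "continuous_on UNIV g" using \<zeta> by (auto simp: C1_along_def)
  obtain M1 where M1: "M1 \<ge> 0" "\<And>x. x \<in> Q \<Longrightarrow> \<bar>\<zeta> x\<bar> \<le> M1" using continuous_bounded_on_Q[OF c(1)] by auto
  obtain M2 where M2: "M2 \<ge> 0" "\<And>x. x \<in> Q \<Longrightarrow> \<bar>g x\<bar> \<le> M2" using continuous_bounded_on_Q[OF c(2)] by auto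
  define h where "h n = (LINT x|lebesgue_on Q. norm (a n x) powr p + norm (b n x) powr p)" for n
  have int_h: "integrable (lebesgue_on Q) (\<lambda>x. norm (a n x) powr p + norm (b n x) powr p)" for n
    using a b by (auto simp: Lp_def)
  have h0: "h n \<ge> 0" for n unfolding h_def by (intro integral_nonneg_AE AE_I2) auto
  have h: "h \<longlonglongrightarrow> 0"
  proof -
    have "(\<lambda>n. (h n powr (1 / p)) powr p) \<longlonglongrightarrow> 0 powr p"
      using lim p unfolding W1p_norm_def h_def a_def b_def
      by (intro tendsto_powr' tendsto_const) auto
    moreover have "(h n powr (1 / p)) powr p = h n" for n
      using h0[of n] p by (simp add: powr_powr)
    ultimately show ?thesis by simp
  qed
  define \<mu> where "\<mu> = (LINT x|lebesgue_on (Q :: (real^'d) set). 1::real) * (M1 + M2)"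
  have \<mu>: "\<mu> \<ge> 0" unfolding \<mu>_def using M1 M2 by (intro mult_nonneg_nonneg) (auto intro!: integral_nonneg_AE)
  \<comment> \<open>The defect \<open>D\<close> of the identity is unchanged when a test function is subtracted from \<open>\<phi>\<close>.\<close>
  define D where "D = (LINT x|lebesgue_on Q. \<phi> x $ i * g x) + (LINT x|lebesgue_on Q. G x $ i $ j * \<zeta> x)"
  have int: "integrable (lebesgue_on Q) (\<lambda>x. \<phi> x $ i * g x)" "integrable (lebesgue_on Q) (\<lambda>x. G x $ i $ j * \<zeta> x)"
    using Lp_integrable_norm(2)[OF \<phi> p] Lp_integrable_norm(2)[OF G p] c
    by (auto intro!: integrable_mult_continuous_Q component_integrable)
  have int_u: "integrable (lebesgue_on Q) (\<lambda>x. u n x $ i * g x)" 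
    "integrable (lebesgue_on Q) (\<lambda>x. jacobian (u n) (at x) $ i $ j * \<zeta> x)" for n
    using cu cDu c by (auto intro!: integrable_continuous_Q continuous_intros)
  have Dn: "D = (LINT x|lebesgue_on Q. a n x $ i * g x + b n x $ i $ j * \<zeta> x)" for n
  proof -
    have "(LINT x|lebesgue_on Q. a n x $ i * g x + b n x $ i $ j * \<zeta> x)
      = (LINT x|lebesgue_on Q. (\<phi> x $ i * g x + G x $ i $ j * \<zeta> x) - (u n x $ i * g x + jacobian (u n) (at x) $ i $ j * \<zeta> x))"
      by (intro Bochner_Integration.integral_cong) (auto simp: a_def b_def algebra_simps)
    also have "\<dots> = D - ((LINT x|lebesgue_on Q. u n x $ i * g x) + (LINT x|lebesgue_on Q. jacobian (u n) (at x) $ i $ j * \<zeta> x))"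
      using int int_u by (simp add: D_def)
    finally show ?thesis
      using test_function_integration_by_parts[OF u \<zeta>, of n i] by simp
  qed
  have est: "\<bar>D\<bar> \<le> \<epsilon> * \<mu> + (M1 + M2) * \<epsilon> powr (1 - p) * h n" if "\<epsilon> > 0" for \<epsilon> n
  proof -
    have "\<bar>D\<bar> \<le> (LINT x|lebesgue_on Q. \<bar>a n x $ i * g x + b n x $ i $ j * \<zeta> x\<bar>)"
      unfolding Dn[of n] by (rule integral_abs_bound)
    also have "\<dots> \<le> (LINT x|lebesgue_on Q. (M1 + M2) * \<epsilon> * 1 + (M1 + M2) * \<epsilon> powr (1 - p) * (norm (a n x) powr p + norm (b n x) powr p))"
    proof (rule integral_mono')
      show "integrable (lebesgue_on Q) (\<lambda>x. (M1 + M2) * \<epsilon> * 1 + (M1 + M2) * \<epsilon> powr (1 - p) * (norm (a n x) powr p + norm (b n x) powr p))"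
        by (rule Bochner_Integration.integrable_add[OF integrable_const_Q integrable_mult_right[OF int_h]])
      fix x :: "real^'d" assume "x \<in> space (lebesgue_on Q)"
      then have x: "x \<in> Q" by simp
      have bij: "\<bar>b n x $ i $ j\<bar> \<le> norm (b n x)"
        using component_le_norm_cart[of "b n x $ i" j] Finite_Cartesian_Product.norm_nth_le[of "b n x" i] by linarith
      have A: "norm y \<le> \<epsilon> + \<epsilon> powr (1 - p) * norm y powr p" for y :: "'q::real_normed_vector"
        using le_eps_plus_powr[of "norm y"] that p by simp
      define E where "E = \<epsilon> + \<epsilon> powr (1 - p) * (norm (a n x) powr p + norm (b n x) powr p)"
      have "norm (a n x) \<le> E" using A[of "a n x"] by (rule order_trans) (simp add: E_def distrib_left)
      then have Ea: "\<bar>a n x $ i\<bar> \<le> E" using component_le_norm_cart[of "a n x" i] by linarith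
      have "norm (b n x) \<le> E" using A[of "b n x"] by (rule order_trans) (simp add: E_def distrib_left)
      then have Eb: "\<bar>b n x $ i $ j\<bar> \<le> E" using bij by linarith
      have "\<bar>a n x $ i * g x + b n x $ i $ j * \<zeta> x\<bar> \<le> \<bar>a n x $ i\<bar> * \<bar>g x\<bar> + \<bar>b n x $ i $ j\<bar> * \<bar>\<zeta> x\<bar>"
        by (metis abs_mult abs_triangle_ineq)
      also have "\<dots> \<le> E * M2 + E * M1"
        using Ea Eb M1 M2 x by (intro add_mono mult_mono) auto
      also have "\<dots> = (M1 + M2) * \<epsilon> * 1 + (M1 + M2) * \<epsilon> powr (1 - p) * (norm (a n x) powr p + norm (b n x) powr p)"
        by (simp add: E_def algebra_simps)
      finally show "\<bar>a n x $ i * g x + b n x $ i $ j * \<zeta> x\<bar> \<le> (M1 + M2) * \<epsilon> * 1 + (M1 + M2) * \<epsilon> powr (1 - p) * (norm (a n x) powr p + norm (b n x) powr p)" .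
    qed (use M1(1) M2(1) that in \<open>auto intro!: add_nonneg_nonneg mult_nonneg_nonneg\<close>)
    also have "\<dots> = \<epsilon> * \<mu> + (M1 + M2) * \<epsilon> powr (1 - p) * h n"
      by (subst Bochner_Integration.integral_add[OF integrable_const_Q integrable_mult_right[OF int_h]])
         (simp add: h_def \<mu>_def)
    finally show ?thesis .
  qed
  have "\<bar>D\<bar> \<le> \<epsilon> * \<mu>" if "\<epsilon> > 0" for \<epsilon>
  proof -
    have "(\<lambda>n. \<epsilon> * \<mu> + (M1 + M2) * \<epsilon> powr (1 - p) * h n) \<longlonglongrightarrow> \<epsilon> * \<mu> + (M1 + M2) * \<epsilon> powr (1 - p) * 0"
      by (intro tendsto_intros h)
    then have "\<bar>D\<bar> \<le> \<epsilon> * \<mu> + (M1 + M2) * \<epsilon> powr (1 - p) * 0"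
      by (rule LIMSEQ_le_const) (use est[OF that] in blast)
    then show ?thesis by simp
  qed
  then have "\<bar>D\<bar> \<le> 0 + \<epsilon>" if "\<epsilon> > 0" for \<epsilon>
  proof -
    have "\<bar>D\<bar> \<le> \<epsilon> / (\<mu> + 1) * \<mu>" using \<open>\<And>\<epsilon>. 0 < \<epsilon> \<Longrightarrow> \<bar>D\<bar> \<le> \<epsilon> * \<mu>\<close>[of "\<epsilon> / (\<mu> + 1)"] that \<mu> by simp
    also have "\<dots> \<le> \<epsilon>" using that \<mu> by (simp add: field_simps)
    finally show ?thesis by simp
  qed
  then have "\<bar>D\<bar> \<le> 0" by (rule field_le_epsilon)
  then show "(LINT x|lebesgue_on Q. \<phi> x $ i * g x) = - (LINT x|lebesgue_on Q. G x $ i $ j * \<zeta> x)"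
    unfolding D_def by simp
qed

lemma zero_trace_gradient_cutoff:
  assumes z: "zero_trace_gradient \<phi> G" and int: "integrable (lebesgue_on Q) \<phi>" "integrable (lebesgue_on Q) G"
    and \<rho>: "\<And>j. C1_along j \<rho> (\<lambda>x. r x $ j)"
  shows "zero_trace_gradient (\<lambda>x. \<rho> x *\<^sub>R \<phi> x) (\<lambda>x. \<rho> x *\<^sub>R G x + outer (\<phi> x) (r x))"
  unfolding zero_trace_gradient_def
proof (intro allI impI)
  fix \<zeta> g :: "real^'a \<Rightarrow> real" and i j assume \<zeta>: "C1_along j \<zeta> g"
  have c: "continuous_on UNIV \<zeta>" "continuous_on UNIV g" "continuous_on UNIV \<rho>" "continuous_on UNIV (\<lambda>x. r x $ j)"
    using \<zeta> \<rho> by (auto simp: C1_along_def)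
  have ints: "integrable (lebesgue_on Q) (\<lambda>x. \<phi> x $ i * (\<rho> x * g x))"
    "integrable (lebesgue_on Q) (\<lambda>x. \<phi> x $ i * (r x $ j * \<zeta> x))"
    "integrable (lebesgue_on Q) (\<lambda>x. G x $ i $ j * (\<rho> x * \<zeta> x))"
    using int c by (auto intro!: integrable_mult_continuous_Q component_integrable continuous_intros)
  have "(LINT x|lebesgue_on Q. \<phi> x $ i * (\<rho> x * g x + r x $ j * \<zeta> x)) = - (LINT x|lebesgue_on Q. G x $ i $ j * (\<rho> x * \<zeta> x))"
    using z C1_along_mult[OF \<rho> \<zeta>] unfolding zero_trace_gradient_def by blast
  then have "(LINT x|lebesgue_on Q. \<phi> x $ i * (\<rho> x * g x)) =
     - (LINT x|lebesgue_on Q. G x $ i $ j * (\<rho> x * \<zeta> x) + \<phi> x $ i * (r x $ j * \<zeta> x))"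
    using ints by (simp add: distrib_left)
  moreover have "(\<lambda>x. (\<rho> x *\<^sub>R \<phi> x) $ i * g x) = (\<lambda>x. \<phi> x $ i * (\<rho> x * g x))"
    "(\<lambda>x. (\<rho> x *\<^sub>R G x + outer (\<phi> x) (r x)) $ i $ j * \<zeta> x) = (\<lambda>x. G x $ i $ j * (\<rho> x * \<zeta> x) + \<phi> x $ i * (r x $ j * \<zeta> x))"
    by (auto simp: outer_def fun_eq_iff algebra_simps)
  ultimately show "(LINT x|lebesgue_on Q. (\<rho> x *\<^sub>R \<phi> x) $ i * g x) =
     - (LINT x|lebesgue_on Q. (\<rho> x *\<^sub>R G x + outer (\<phi> x) (r x)) $ i $ j * \<zeta> x)"
    by simp
qed

text \<open>Take the constant \<open>1\<close> as multiplier. This removes the term that is linear in the gradient from the quasiconvexity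
inequality.\<close>

lemma zero_trace_gradient_integral_eq_0:
  assumes z: "zero_trace_gradient \<phi> G" and int: "integrable (lebesgue_on Q) G"
  shows "(LINT x|lebesgue_on Q. H \<bullet> G x) = 0"
proof -
  have "C1_along j (\<lambda>x. 1) (\<lambda>x. 0)" for j :: 'a by (simp add: C1_along_def)
  then have "(LINT x|lebesgue_on Q. G x $ i $ j) = 0" for i j
    using z unfolding zero_trace_gradient_def by fastforce
  then have "(LINT x|lebesgue_on Q. (\<Sum>i\<in>UNIV. \<Sum>j\<in>UNIV. H $ i $ j * G x $ i $ j)) = 0"
    using component_integrable(2)[OF int] by (simp add: Bochner_Integration.integral_sum)
  then show ?thesis by (simp add: inner_vec_def)
qed

section \<open>Periodic extension and quasiconvexity\<close>

definition lattice_vec :: "('d \<Rightarrow> int) \<Rightarrow> real^'d" where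
  "lattice_vec k = (\<chi> i. of_int (k i))"

definition lattice_box :: "nat \<Rightarrow> ('d::finite \<Rightarrow> int) set" where
  "lattice_box M = {k. \<forall>i. k i \<in> {- int M..int M}}"

text \<open>The extension of \<open>f\<close> from the open unit cube with period one, equal to \<open>0\<close> on the faces, which form a null set.\<close>

definition per :: "(real^'d \<Rightarrow> 'b::zero) \<Rightarrow> real^'d \<Rightarrow> 'b" where
  "per f x = (if (\<chi> i. frac (x $ i)) \<in> Q then f (\<chi> i. frac (x $ i)) else 0)"

lemma finite_lattice_box: "finite (lattice_box M :: ('d::finite \<Rightarrow> int) set)"
proof -
  have "lattice_box M = (UNIV \<rightarrow>\<^sub>E {- int M..int M} :: ('d \<Rightarrow> int) set)"
    by (auto simp: lattice_box_def PiE_def Pi_def)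
  then show ?thesis by (simp add: finite_PiE)
qed

lemma Q_translate_iff:
  fixes x :: "real^'d"
  shows "x - lattice_vec k \<in> Q \<longleftrightarrow> (\<chi> i. frac (x $ i)) \<in> Q \<and> k = (\<lambda>i. \<lfloor>x $ i\<rfloor>)"
proof
  assume *: "x - lattice_vec k \<in> Q"
  have k: "k i = \<lfloor>x $ i\<rfloor>" for i
    using * by (auto simp: Q_def lattice_vec_def intro!: floor_unique[symmetric] dest!: spec[of _ i])
  then have "x - lattice_vec k = (\<chi> i. frac (x $ i))"
    by (simp add: vec_eq_iff lattice_vec_def frac_def)
  then show "(\<chi> i. frac (x $ i)) \<in> Q \<and> k = (\<lambda>i. \<lfloor>x $ i\<rfloor>)" using * k by auto
next
  assume *: "(\<chi> i. frac (x $ i)) \<in> Q \<and> k = (\<lambda>i. \<lfloor>x $ i\<rfloor>)"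
  then have "x - lattice_vec k = (\<chi> i. frac (x $ i))"
    by (simp add: vec_eq_iff lattice_vec_def frac_def)
  then show "x - lattice_vec k \<in> Q" using * by simp
qed

text \<open>On a bounded set the periodic extension is a finite sum of translates of \<open>f\<close>, each living on its own cube. All
integrals of it are thereby reduced to integrals over \<open>Q\<close>.\<close>

lemma per_eq_sum:
  fixes f :: "real^'d \<Rightarrow> 'b::real_normed_vector"
  assumes "norm x \<le> real M"
  shows "per f x = (\<Sum>k\<in>lattice_box M. indicator Q (x - lattice_vec k) *\<^sub>R f (x - lattice_vec k))"
proof -
  define k where "k = (\<lambda>i. \<lfloor>x $ i\<rfloor>)"
  have "k i \<in> {- int M..int M}" for i
  proof -
    have "\<bar>x $ i\<bar> \<le> real M" using component_le_norm_cart[of x i] assms by linarith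
    then show ?thesis by (auto simp: k_def le_floor_iff floor_le_iff abs_le_iff)
  qed
  then have kM: "k \<in> lattice_box M" by (simp add: lattice_box_def)
  have "(\<Sum>k\<in>lattice_box M. indicator Q (x - lattice_vec k) *\<^sub>R f (x - lattice_vec k))
     = (\<Sum>l\<in>lattice_box M. if l = k then indicator Q (x - lattice_vec l) *\<^sub>R f (x - lattice_vec l) else 0)"
    by (intro sum.cong) (auto simp: Q_translate_iff k_def indicator_def)
  also have "\<dots> = indicator Q (x - lattice_vec k) *\<^sub>R f (x - lattice_vec k)"
    by (subst sum.delta[OF finite_lattice_box]) (use kM in simp)
  also have "\<dots> = per f x"
  proof -
    have "x - lattice_vec k = (\<chi> i. frac (x $ i))"
      by (simp add: vec_eq_iff lattice_vec_def frac_def k_def)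
    then show ?thesis by (simp add: per_def indicator_def)
  qed
  finally show ?thesis by simp
qed

lemma per_eq_on_Q:
  assumes "x \<in> Q"
  shows "per f x = f x"
proof -
  have "(\<chi> i. frac (x $ i)) = x"
    using assms by (auto simp: vec_eq_iff Q_def frac_eq less_imp_le)
  then show ?thesis using assms by (simp add: per_def)
qed

lemma periodic_per:
  fixes f :: "real^'d \<Rightarrow> 'b::zero"
  shows "periodic (per f)"
proof -
  have "(\<chi> i. frac ((x + axis j 1) $ i)) = (\<chi> i. frac (x $ i))" for x :: "real^'d" and j
    by (simp add: axis_def frac_1_eq vec_eq_iff)
  then show ?thesis unfolding periodic_def per_def by (simp only: simp_thms)
qed

lemma integrable_translated_Q:
  fixes f :: "real^'d \<Rightarrow> 'b::{banach, second_countable_topology}"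
  assumes "integrable (lebesgue_on Q) f"
  shows "integrable lebesgue (\<lambda>x. indicator Q (x - c) *\<^sub>R f (x - c))"
    and "(LINT x|lebesgue. indicator Q (x - c) *\<^sub>R f (x - c)) = (LINT x|lebesgue_on Q. f x)"
proof -
  have "integrable lebesgue (\<lambda>x. indicator Q x *\<^sub>R f x)"
    using assms by (simp add: integrable_restrict_space)
  from lebesgue_integral_translation[OF this, of "- c"]
  show "integrable lebesgue (\<lambda>x. indicator Q (x - c) *\<^sub>R f (x - c))"
    "(LINT x|lebesgue. indicator Q (x - c) *\<^sub>R f (x - c)) = (LINT x|lebesgue_on Q. f x)"
    by (simp_all add: integral_restrict_space)
qed

lemma per_absolutely_integrable:
  fixes f :: "real^'d \<Rightarrow> 'b::euclidean_space"
  assumes f: "integrable (lebesgue_on Q) f" and S: "compact S"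
  shows "per f absolutely_integrable_on S"
proof -
  obtain R where "\<And>x. x \<in> S \<Longrightarrow> norm x \<le> R"
    using compact_imp_bounded[OF S] by (auto simp: bounded_iff)
  then obtain M :: nat where M: "\<And>x. x \<in> S \<Longrightarrow> norm x \<le> real M"
    by (meson order_trans real_arch_simple)
  have "integrable lebesgue (\<lambda>x. \<Sum>k\<in>lattice_box M. indicator S x *\<^sub>R (indicator Q (x - lattice_vec k) *\<^sub>R f (x - lattice_vec k)))"
    using S by (intro Bochner_Integration.integrable_sum integrable_mult_indicator integrable_translated_Q f)
      (auto simp: lmeasurable_compact fmeasurableD)
  moreover have "(\<lambda>x. \<Sum>k\<in>lattice_box M. indicator S x *\<^sub>R (indicator Q (x - lattice_vec k) *\<^sub>R f (x - lattice_vec k)))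
     = (\<lambda>x. indicator S x *\<^sub>R per f x)"
  proof
    fix x
    show "(\<Sum>k\<in>lattice_box M. indicator S x *\<^sub>R (indicator Q (x - lattice_vec k) *\<^sub>R f (x - lattice_vec k))) = indicator S x *\<^sub>R per f x"
      by (cases "x \<in> S") (simp_all add: per_eq_sum[OF M])
  qed
  ultimately show ?thesis by (simp add: set_integrable_def)
qed

text \<open>Unfolding: each translate of the cube contributes an integral over \<open>Q\<close> against a translate of \<open>c\<close>.\<close>

lemma integral_per_mult:
  fixes f c :: "real^'d \<Rightarrow> real"
  assumes f: "integrable (lebesgue_on Q) f" and c: "continuous_on UNIV c" "\<And>x. norm x > real M \<Longrightarrow> c x = 0"
  shows "(LINT x|lebesgue. per f x * c x) = (\<Sum>k\<in>lattice_box M. LINT x|lebesgue_on Q. f x * c (x + lattice_vec k))"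
proof -
  have int: "integrable (lebesgue_on Q) (\<lambda>x. f x * c (x + lattice_vec k))" for k
    using c by (intro integrable_mult_continuous_Q f continuous_on_compose2[OF c(1)]) (auto intro!: continuous_intros)
  have "per f x * c x = (\<Sum>k\<in>lattice_box M. indicator Q (x - lattice_vec k) *\<^sub>R (f (x - lattice_vec k) * c ((x - lattice_vec k) + lattice_vec k)))" for x
  proof (cases "norm x > real M")
    case True
    then show ?thesis by (simp add: c(2))
  next
    case False
    then show ?thesis by (subst per_eq_sum[of _ M]) (auto simp: sum_distrib_right mult.assoc)
  qed
  then have "(LINT x|lebesgue. per f x * c x) =
    (LINT x|lebesgue. (\<Sum>k\<in>lattice_box M. indicator Q (x - lattice_vec k) *\<^sub>R (f (x - lattice_vec k) * c ((x - lattice_vec k) + lattice_vec k))))"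
    by presburger
  also have "\<dots> = (\<Sum>k\<in>lattice_box M. LINT x|lebesgue. indicator Q (x - lattice_vec k) *\<^sub>R (f (x - lattice_vec k) * c ((x - lattice_vec k) + lattice_vec k)))"
    by (intro Bochner_Integration.integral_sum integrable_translated_Q(1)[OF int])
  also have "\<dots> = (\<Sum>k\<in>lattice_box M. LINT x|lebesgue_on Q. f x * c (x + lattice_vec k))"
    by (intro sum.cong refl integrable_translated_Q(2)[OF int])
  finally show ?thesis .
qed

lemma C1_along_translate:
  assumes "C1_along j \<zeta> g"
  shows "C1_along j (\<lambda>x. \<zeta> (x + c)) (\<lambda>x. g (x + c))"
  unfolding C1_along_def
proof (intro conjI allI)
  show "continuous_on UNIV (\<lambda>x. \<zeta> (x + c))" "continuous_on UNIV (\<lambda>x. g (x + c))"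
    using assms unfolding C1_along_def
    by (auto intro!: continuous_intros continuous_on_compose2[of UNIV \<zeta>] continuous_on_compose2[of UNIV g])
  fix x
  have "((\<lambda>t. \<zeta> (x + c + t *\<^sub>R axis j 1)) has_real_derivative g (x + c)) (at 0)"
    using assms unfolding C1_along_def by blast
  then show "((\<lambda>t. \<zeta> (x + t *\<^sub>R axis j 1 + c)) has_real_derivative g (x + c)) (at 0)"
    by (simp add: algebra_simps)
qed

text \<open>After unfolding, a test function on the whole space becomes a finite family of multipliers on \<open>Q\<close> which do not
vanish on the boundary; the zero trace identity applies to each of them.\<close>

lemma W1p_per_extension:
  assumes z: "zero_trace_gradient \<phi> G" and \<phi>: "\<phi> \<in> Lp p Q" and G: "G \<in> Lp p Q" and p: "1 \<le> p"
  shows "W1p_per p (per \<phi>) (per G)"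
proof -
  have int: "integrable (lebesgue_on Q) \<phi>" "integrable (lebesgue_on Q) G"
    using Lp_integrable_norm(2)[OF \<phi> p] Lp_integrable_norm(2)[OF G p] .
  have L: "per f \<in> Lp p Q" if "f \<in> Lp p Q" for f :: "real^'a \<Rightarrow> 'c::euclidean_space"
  proof (rule Lp_dominated[OF that])
    show "per f \<in> borel_measurable (lebesgue_on Q)"
      using Lp_measurable[OF that] by (subst measurable_cong[where g = f]) (auto simp: per_eq_on_Q)
    show "norm (per f x) \<le> 1 * norm (f x)" if "x \<in> Q" for x using that by (simp add: per_eq_on_Q)
  qed (use p in auto)
  have w: "(LINT x|lebesgue. per \<phi> x $ i * frechet_derivative \<zeta> (at x) (axis j 1)) = - (LINT x|lebesgue. per G x $ i $ j * \<zeta> x)"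
    if \<zeta>: "test_function UNIV \<zeta>" for \<zeta> :: "real^'a \<Rightarrow> real" and i j
  proof -
    define g where "g x = frechet_derivative \<zeta> (at x) (axis j 1)" for x
    have c: "C1_along j \<zeta> g" unfolding g_def by (rule C1_along_test_function[OF \<zeta>])
    define S where "S = closure {x. \<zeta> x \<noteq> 0}"
    have S: "compact S" "\<And>x. x \<notin> S \<Longrightarrow> \<zeta> x = 0"
      using \<zeta> closure_subset[of "{x. \<zeta> x \<noteq> 0}"] by (auto simp: S_def test_function_def)
    have Sg: "g x = 0" if "x \<notin> S" for x
      using S that by (intro C1_along_eq_0[OF c, of "- S"]) (auto simp: compact_imp_closed open_Compl)
    obtain R where "\<And>x. x \<in> S \<Longrightarrow> norm x \<le> R"
      using compact_imp_bounded[OF S(1)] by (auto simp: bounded_iff)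
    then obtain M :: nat where M: "\<And>x. x \<in> S \<Longrightarrow> norm x \<le> real M"
      by (meson order_trans real_arch_simple)
    have per_comp: "(\<lambda>x. per \<phi> x $ i) = per (\<lambda>x. \<phi> x $ i)" "(\<lambda>x. per G x $ i $ j) = per (\<lambda>x. G x $ i $ j)"
      by (auto simp: per_def fun_eq_iff)
    have "(LINT x|lebesgue. per (\<lambda>x. \<phi> x $ i) x * g x) = (\<Sum>k\<in>lattice_box M. LINT x|lebesgue_on Q. \<phi> x $ i * g (x + lattice_vec k))"
      using c Sg M by (intro integral_per_mult component_integrable int) (force simp: C1_along_def)+
    also have "\<dots> = (\<Sum>k\<in>lattice_box M. - (LINT x|lebesgue_on Q. G x $ i $ j * \<zeta> (x + lattice_vec k)))"
      using z C1_along_translate[OF c] unfolding zero_trace_gradient_def by (intro sum.cong refl) blast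
    also have "\<dots> = - (\<Sum>k\<in>lattice_box M. LINT x|lebesgue_on Q. G x $ i $ j * \<zeta> (x + lattice_vec k))"
      by (simp add: sum_negf)
    also have "(\<Sum>k\<in>lattice_box M. LINT x|lebesgue_on Q. G x $ i $ j * \<zeta> (x + lattice_vec k)) = (LINT x|lebesgue. per (\<lambda>x. G x $ i $ j) x * \<zeta> x)"
      using c S M by (intro integral_per_mult[symmetric] component_integrable int) (force simp: C1_along_def)+
    finally show ?thesis by (simp add: per_comp[unfolded fun_eq_iff] g_def)
  qed
  show ?thesis
    unfolding W1p_per_def weak_gradient_def
    using w by (auto simp: periodic_per L \<phi> G integral_restrict_space intro!: per_absolutely_integrable int)
qed

lemma integrable_taylor_rem:
  fixes e :: "(real^'d^'d) \<times> real \<Rightarrow> real" and G :: "real^'d \<Rightarrow> real^'d^'d"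
  assumes e: "Ck 3 e" and G: "G \<in> Lp p Q" and \<psi>: "\<psi> \<in> Lp q Q" and pq: "2 \<le> p" "2 \<le> q"
    and W: "continuous_on UNIV W" "\<And>x. x \<in> Q \<Longrightarrow> norm (W x) \<le> K"
    and C: "\<And>w z. norm w \<le> K \<Longrightarrow> \<bar>taylor_rem e w z\<bar> \<le> C * excess p q z" "C \<ge> 0"
  shows "integrable (lebesgue_on Q) (\<lambda>x. taylor_rem e (W x) (G x, \<psi> x))"
proof (rule Bochner_Integration.integrable_bound)
  show "integrable (lebesgue_on Q) (\<lambda>x. C * excess p q (G x, \<psi> x))"
    unfolding excess_def using Lp_integrable_V[OF G pq(1)] Lp_integrable_V[OF \<psi> pq(2)] by simp
  have ce: "continuous_on UNIV e"
    using Ck3_partials(1)[OF e] by (simp add: continuous_at_imp_continuous_on differentiable_imp_continuous_within)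
  have Z: "(\<lambda>x. (G x, \<psi> x)) \<in> borel_measurable (lebesgue_on Q)"
    using Lp_measurable[OF G] Lp_measurable[OF \<psi>] by (rule borel_measurable_Pair)
  have Wm: "W \<in> borel_measurable (lebesgue_on Q)"
    by (rule continuous_measurable_Q[OF W(1)])
  have 1: "(\<lambda>x. e (W x + (G x, \<psi> x))) \<in> borel_measurable (lebesgue_on Q)"
    by (rule borel_measurable_continuous_on[OF ce borel_measurable_add[OF Wm Z]])
  have 2: "(\<lambda>x. e (W x)) \<in> borel_measurable (lebesgue_on Q)"
    by (rule borel_measurable_continuous_on[OF ce Wm])
  have "(\<lambda>x. \<Sum>i\<in>Basis. ((G x, \<psi> x) \<bullet> i) * frechet_derivative e (at (W x)) i) \<in> borel_measurable (lebesgue_on Q)"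
    by (intro borel_measurable_sum borel_measurable_times borel_measurable_inner Z borel_measurable_const
        borel_measurable_continuous_on[OF Ck3_partials(3)[OF e] Wm])
  then have 3: "(\<lambda>x. frechet_derivative e (at (W x)) (G x, \<psi> x)) \<in> borel_measurable (lebesgue_on Q)"
    by (subst frechet_derivative_Basis_sum[OF Ck3_partials(1)[OF e]])
  show "(\<lambda>x. taylor_rem e (W x) (G x, \<psi> x)) \<in> borel_measurable (lebesgue_on Q)"
    unfolding taylor_rem_def by (intro borel_measurable_diff 1 2 3)
  show "AE x in lebesgue_on Q. norm (taylor_rem e (W x) (G x, \<psi> x)) \<le> norm (C * excess p q (G x, \<psi> x))"
  proof (rule AE_I2)
    fix x :: "real^'d" assume "x \<in> space (lebesgue_on Q)"
    then have "x \<in> Q" by simp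
    from C(1)[OF W(2)[OF this], of "(G x, \<psi> x)"]
    show "norm (taylor_rem e (W x) (G x, \<psi> x)) \<le> norm (C * excess p q (G x, \<psi> x))"
      by (simp only: real_norm_def)
  qed
qed

text \<open>Strong quasiconvexity is stated without the linear term in the gradient; for zero traces this term
integrates to zero, and the inequality becomes one for the relative energy with a constant base state \<open>w\<close>.\<close>

lemma quasiconvexity_zero_trace:
  fixes e :: "(real^'d^'d) \<times> real \<Rightarrow> real"
  assumes sq: "\<And>F \<eta> \<phi> G \<psi>. W1p_per p \<phi> G \<Longrightarrow> \<psi> \<in> Lp q Q \<Longrightarrow>
     c\<^sub>0 * (LINT x|lebesgue_on Q. \<bar>V p (G x)\<bar>\<^sup>2 + \<bar>V q (\<psi> x)\<bar>\<^sup>2)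
     \<le> (LINT x|lebesgue_on Q. e (F + G x, \<eta> + \<psi> x) - e (F, \<eta>) - deriv_eta e (F, \<eta>) * \<psi> x)"
    and e: "Ck 3 e" and z: "zero_trace_gradient \<phi> G" and \<phi>: "\<phi> \<in> Lp p Q" and G: "G \<in> Lp p Q" and \<psi>: "\<psi> \<in> Lp q Q"
    and pq: "2 \<le> p" "2 \<le> q"
    and int: "integrable (lebesgue_on Q) (\<lambda>x. taylor_rem e w (G x, \<psi> x))"
  shows "c\<^sub>0 * (LINT x|lebesgue_on Q. excess p q (G x, \<psi> x)) \<le> (LINT x|lebesgue_on Q. taylor_rem e w (G x, \<psi> x))"
proof -
  obtain F \<eta> where w: "w = (F, \<eta>)" by (cases w)
  have p1: "1 \<le> p" using pq by simp
  have intG: "integrable (lebesgue_on Q) (\<lambda>x. grad_F e w \<bullet> G x)"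
    using Lp_integrable_norm(2)[OF G p1] by simp
  have "c\<^sub>0 * (LINT x|lebesgue_on Q. excess p q (G x, \<psi> x)) = 
     c\<^sub>0 * (LINT x|lebesgue_on Q. \<bar>V p (per G x)\<bar>\<^sup>2 + \<bar>V q (\<psi> x)\<bar>\<^sup>2)"
    by (intro arg_cong[where f = "\<lambda>t. c\<^sub>0 * t"] Bochner_Integration.integral_cong) (auto simp: per_eq_on_Q excess_def)
  also have "\<dots> \<le> (LINT x|lebesgue_on Q. e (F + per G x, \<eta> + \<psi> x) - e (F, \<eta>) - deriv_eta e (F, \<eta>) * \<psi> x)"
    by (rule sq[OF W1p_per_extension[OF z \<phi> G p1] \<psi>])
  also have "\<dots> = (LINT x|lebesgue_on Q. taylor_rem e w (G x, \<psi> x) + grad_F e w \<bullet> G x)"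
    by (intro Bochner_Integration.integral_cong)
      (auto simp: per_eq_on_Q taylor_rem_def w frechet_derivative_partials[OF Ck3_partials(1)[OF e]])
  also have "\<dots> = (LINT x|lebesgue_on Q. taylor_rem e w (G x, \<psi> x))"
    using int intG zero_trace_gradient_integral_eq_0[OF z Lp_integrable_norm(2)[OF G p1]] by simp
  finally show ?thesis .
qed

section \<open>Cutoffs on translated grids\<close>

text \<open>A quadratic spline that is continuously differentiable and rises from 0 to 1 on the unit interval.\<close>

definition ramp :: "real \<Rightarrow> real" where
  "ramp t = 2 * (max 0 t)\<^sup>2 - 4 * (max 0 (t - 1/2))\<^sup>2 + 2 * (max 0 (t - 1))\<^sup>2"

definition ramp_deriv :: "real \<Rightarrow> real" where
  "ramp_deriv t = 4 * max 0 t - 8 * max 0 (t - 1/2) + 4 * max 0 (t - 1)"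

lemma DERIV_truncated_square: "((\<lambda>t::real. (max 0 (t - c))\<^sup>2) has_real_derivative 2 * max 0 (x - c)) (at x)"
proof -
  consider "x < c" | "x = c" | "x > c" by linarith
  then show ?thesis
  proof cases
    case 1
    have "((\<lambda>t. 0) has_real_derivative 2 * max 0 (x - c)) (at x)" using 1 by simp
    then show ?thesis
      by (rule has_field_derivative_transform_within_open[where S = "{..<c}"]) (use 1 in auto)
  next
    case 3
    have "((\<lambda>t. (t - c)\<^sup>2) has_real_derivative 2 * max 0 (x - c)) (at x)"
      using 3 by (auto intro!: derivative_eq_intros)
    then show ?thesis
      by (rule has_field_derivative_transform_within_open[where S = "{c<..}"]) (use 3 in auto)
  next
    case 2
    have "((\<lambda>h. (max 0 h)\<^sup>2 / h) \<longlongrightarrow> 0) (at (0::real))"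
    proof (rule Lim_null_comparison)
      show "\<forall>\<^sub>F h in at (0::real). norm ((max 0 h)\<^sup>2 / h) \<le> \<bar>h\<bar>"
        by (intro always_eventually allI) (auto simp: max_def power2_eq_square)
      show "((\<lambda>h::real. \<bar>h\<bar>) \<longlongrightarrow> 0) (at 0)"
        using tendsto_rabs[OF tendsto_ident_at[of "0::real" UNIV]] by simp
    qed
    then show ?thesis unfolding DERIV_def using 2 by simp
  qed
qed

lemma DERIV_ramp: "(ramp has_real_derivative ramp_deriv x) (at x)"
proof -
  have 0: "((\<lambda>t::real. (max 0 t)\<^sup>2) has_real_derivative 2 * max 0 x) (at x)"
    using DERIV_truncated_square[of 0 x] by simp
  have "((\<lambda>t. 2 * (max 0 t)\<^sup>2 - 4 * (max 0 (t - 1/2))\<^sup>2 + 2 * (max 0 (t - 1))\<^sup>2) has_real_derivative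
     2 * (2 * max 0 x) - 4 * (2 * max 0 (x - 1/2)) + 2 * (2 * max 0 (x - 1))) (at x)"
    by (intro DERIV_add DERIV_diff DERIV_cmult DERIV_truncated_square 0)
  moreover have "(\<lambda>t. 2 * (max 0 t)\<^sup>2 - 4 * (max 0 (t - 1/2))\<^sup>2 + 2 * (max 0 (t - 1))\<^sup>2) = ramp"
    by (simp add: ramp_def fun_eq_iff)
  ultimately show ?thesis by (simp add: ramp_deriv_def)
qed

lemma ramp_eq: "t \<le> 0 \<Longrightarrow> ramp t = 0" "t \<ge> 1 \<Longrightarrow> ramp t = 1"
  "t \<le> 0 \<Longrightarrow> ramp_deriv t = 0" "t \<ge> 1 \<Longrightarrow> ramp_deriv t = 0"
  by (auto simp: ramp_def ramp_deriv_def max_def power2_eq_square algebra_simps)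

lemma ramp_deriv_bounds: "0 \<le> ramp_deriv t" "ramp_deriv t \<le> 2"
  by (auto simp: ramp_deriv_def max_def)

lemma ramp_bounds: "0 \<le> ramp t" "ramp t \<le> 1"
proof -
  have mono: "ramp a \<le> ramp b" if "a \<le> b" for a b
    using DERIV_ramp ramp_deriv_bounds(1) by (intro DERIV_nonneg_imp_nondecreasing[OF that]) blast
  show "0 \<le> ramp t" using mono[of 0 t] ramp_eq(1)[of t] ramp_eq(1)[of 0] by (cases "t \<le> 0") auto
  show "ramp t \<le> 1" using mono[of t 1] ramp_eq(2)[of t] ramp_eq(2)[of 1] by (cases "t \<le> 1") auto
qed

lemma continuous_ramp: "continuous_on S ramp" "continuous_on S ramp_deriv"
  unfolding ramp_def ramp_deriv_def by (intro continuous_intros)+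

text \<open>A bump supported in \<open>{0..m}\<close> and equal to 1 on \<open>{1/2..m - 1/2}\<close>.\<close>

definition plateau :: "real \<Rightarrow> real \<Rightarrow> real" where
  "plateau m t = ramp (2 * t) * ramp (2 * (m - t))"

definition plateau_deriv :: "real \<Rightarrow> real \<Rightarrow> real" where
  "plateau_deriv m t = 2 * ramp_deriv (2 * t) * ramp (2 * (m - t)) - 2 * ramp (2 * t) * ramp_deriv (2 * (m - t))"

lemma DERIV_plateau: "(plateau m has_real_derivative plateau_deriv m t) (at t)"
proof -
  have 1: "((\<lambda>t. ramp (2 * t)) has_real_derivative ramp_deriv (2 * t) * 2) (at t)"
    by (rule DERIV_chain2[OF DERIV_ramp]) (auto intro!: derivative_eq_intros)
  have 2: "((\<lambda>t. ramp (2 * (m - t))) has_real_derivative ramp_deriv (2 * (m - t)) * (- 2)) (at t)"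
    by (rule DERIV_chain2[OF DERIV_ramp]) (auto intro!: derivative_eq_intros)
  have "((\<lambda>t. ramp (2 * t) * ramp (2 * (m - t))) has_real_derivative
    (ramp_deriv (2 * t) * 2) * ramp (2 * (m - t)) + (ramp_deriv (2 * (m - t)) * (- 2)) * ramp (2 * t)) (at t)"
    by (rule DERIV_mult[OF 1 2])
  moreover have "(\<lambda>t. ramp (2 * t) * ramp (2 * (m - t))) = plateau m" by (simp add: plateau_def fun_eq_iff)
  ultimately show ?thesis by (simp add: plateau_deriv_def algebra_simps)
qed

lemma continuous_plateau: "continuous_on S (plateau m)" "continuous_on S (plateau_deriv m)"
  unfolding plateau_def plateau_deriv_def
  by (intro continuous_intros continuous_on_compose2[OF continuous_ramp(1)[of UNIV]]
      continuous_on_compose2[OF continuous_ramp(2)[of UNIV]]; simp)+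

lemma plateau_bounds: "0 \<le> plateau m t" "plateau m t \<le> 1"
  using ramp_bounds by (auto simp: plateau_def mult_le_one)

lemma plateau_deriv_bound: "\<bar>plateau_deriv m t\<bar> \<le> 8"
proof -
  have *: "\<bar>2 * ramp_deriv a * ramp b\<bar> \<le> 4" for a b
  proof -
    have "\<bar>ramp_deriv a\<bar> * \<bar>ramp b\<bar> \<le> 2 * 1"
      using ramp_bounds[of b] ramp_deriv_bounds[of a] by (intro mult_mono) auto
    moreover have "\<bar>2 * ramp_deriv a * ramp b\<bar> = 2 * (\<bar>ramp_deriv a\<bar> * \<bar>ramp b\<bar>)" by (simp add: abs_mult)
    ultimately show ?thesis by linarith
  qed
  show ?thesis
    using *[of "2 * t" "2 * (m - t)"] *[of "2 * (m - t)" "2 * t"] unfolding plateau_deriv_def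
    by (simp add: mult.commute mult.left_commute)
qed

lemma plateau_outside:
  assumes "t \<le> 0 \<or> m \<le> t"
  shows "plateau m t = 0" "plateau_deriv m t = 0"
  using assms by (auto simp: plateau_def plateau_deriv_def ramp_eq)

lemma plateau_inside:
  assumes "1/2 \<le> t" "t \<le> m - 1/2"
  shows "plateau m t = 1" "plateau_deriv m t = 0"
  using assms by (auto simp: plateau_def plateau_deriv_def ramp_eq)

text \<open>Scale by \<open>A\<close>, so that the unit cube has \<open>A\<close> ticks in each direction. For each offset \<open>j < m\<close> the
hyperplanes through the ticks congruent to \<open>j\<close> modulo \<open>m\<close> cut the space into cubes of side \<open>m / A\<close>, indexed by integer
vectors \<open>k\<close>. The coordinates in a cell run from \<open>0\<close> to \<open>m\<close>.\<close>

definition cell_coord :: "nat \<Rightarrow> nat \<Rightarrow> nat \<Rightarrow> ('d \<Rightarrow> int) \<Rightarrow> real^'d \<Rightarrow> 'd \<Rightarrow> real" where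
  "cell_coord A m j k x i = real A * x $ i - real j - real m * of_int (k i)"

definition cell :: "nat \<Rightarrow> nat \<Rightarrow> nat \<Rightarrow> real^'d \<Rightarrow> 'd \<Rightarrow> int" where
  "cell A m j x i = \<lfloor>(real A * x $ i - real j) / real m\<rfloor>"

text \<open>The points within half a tick of a hyperplane of the grid with offset \<open>j\<close>. In terms of the nearest tick, the
layers of different offsets are visibly disjoint in each coordinate direction.\<close>

definition layer :: "nat \<Rightarrow> nat \<Rightarrow> nat \<Rightarrow> (real^'d) set" where
  "layer A m j = {x. \<exists>i. round (real A * x $ i) mod int m = int j}"

definition cutoff :: "nat \<Rightarrow> nat \<Rightarrow> nat \<Rightarrow> ('d \<Rightarrow> int) \<Rightarrow> real^'d \<Rightarrow> real" where
  "cutoff A m j k x = (\<Prod>i\<in>UNIV. plateau (real m) (cell_coord A m j k x i))"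

definition cutoff_grad :: "nat \<Rightarrow> nat \<Rightarrow> nat \<Rightarrow> ('d \<Rightarrow> int) \<Rightarrow> real^'d \<Rightarrow> real^'d" where
  "cutoff_grad A m j k x = (\<chi> i. real A * plateau_deriv (real m) (cell_coord A m j k x i) *
     (\<Prod>l\<in>UNIV - {i}. plateau (real m) (cell_coord A m j k x l)))"

lemma continuous_cell_coord: "continuous_on S (\<lambda>x. cell_coord A m j k x i)"
  unfolding cell_coord_def by (intro continuous_intros)

lemma C1_along_cutoff: "C1_along i (cutoff A m j k) (\<lambda>x. cutoff_grad A m j k x $ i)"
  unfolding C1_along_def
proof (intro conjI allI)
  show "continuous_on UNIV (cutoff A m j k)"
    unfolding cutoff_def
    by (intro continuous_on_prod continuous_on_compose2[OF continuous_plateau(1)[of UNIV] continuous_cell_coord]) auto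
  show "continuous_on UNIV (\<lambda>x. cutoff_grad A m j k x $ i)"
    unfolding cutoff_grad_def vec_lambda_beta
    by (intro continuous_intros continuous_on_compose2[OF continuous_plateau(1)[of UNIV] continuous_cell_coord]
       continuous_on_compose2[OF continuous_plateau(2)[of UNIV] continuous_cell_coord]) auto
  fix x :: "real^'a"
  define P where "P = (\<Prod>l\<in>UNIV - {i}. plateau (real m) (cell_coord A m j k x l))"
  have cc: "cell_coord A m j k (x + t *\<^sub>R axis i 1) l = cell_coord A m j k x l + (if l = i then real A * t else 0)" for t l
    by (simp add: cell_coord_def axis_def algebra_simps)
  have eq: "cutoff A m j k (x + t *\<^sub>R axis i 1) = plateau (real m) (cell_coord A m j k x i + real A * t) * P" for t
  proof -
    have "cutoff A m j k (x + t *\<^sub>R axis i 1) =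
      plateau (real m) (cell_coord A m j k (x + t *\<^sub>R axis i 1) i) *
       (\<Prod>l\<in>UNIV - {i}. plateau (real m) (cell_coord A m j k (x + t *\<^sub>R axis i 1) l))"
      unfolding cutoff_def by (rule prod.remove) auto
    then show ?thesis by (simp add: cc P_def)
  qed
  have "((\<lambda>t. plateau (real m) (cell_coord A m j k x i + real A * t)) has_real_derivative
    plateau_deriv (real m) (cell_coord A m j k x i + real A * 0) * real A) (at 0)"
    by (rule DERIV_chain2[OF DERIV_plateau]) (auto intro!: derivative_eq_intros)
  from DERIV_mult[OF this DERIV_const[of P]]
  show "((\<lambda>t. cutoff A m j k (x + t *\<^sub>R axis i 1)) has_real_derivative cutoff_grad A m j k x $ i) (at 0)"
    unfolding eq by (simp add: cutoff_grad_def P_def mult_ac)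
qed

lemma cutoff_bounds: "0 \<le> cutoff A m j k x" "cutoff A m j k x \<le> 1"
  unfolding cutoff_def using plateau_bounds by (auto intro!: prod_nonneg prod_le_1)

lemma norm_cutoff_grad: 
  fixes x :: "real^'d"
  shows "norm (cutoff_grad A m j k x) \<le> real CARD('d) * (8 * real A)"
proof -
  have "norm (cutoff_grad A m j k x) \<le> (\<Sum>i\<in>UNIV. \<bar>cutoff_grad A m j k x $ i\<bar>)"
    by (rule norm_le_l1_cart)
  also have "\<dots> \<le> (\<Sum>i\<in>(UNIV::'d set). 8 * real A)"
  proof (rule sum_mono)
    fix i
    define P where "P = (\<Prod>l\<in>UNIV - {i}. plateau (real m) (cell_coord A m j k x l))"
    have P: "0 \<le> P" "P \<le> 1" unfolding P_def using plateau_bounds by (auto intro!: prod_nonneg prod_le_1)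
    have "\<bar>plateau_deriv (real m) (cell_coord A m j k x i)\<bar> * P \<le> 8 * 1"
      using plateau_deriv_bound P by (intro mult_mono) auto
    then have "real A * (\<bar>plateau_deriv (real m) (cell_coord A m j k x i)\<bar> * P) \<le> real A * (8 * 1)"
      by (intro mult_left_mono) auto
    then show "\<bar>cutoff_grad A m j k x $ i\<bar> \<le> 8 * real A"
      using P by (simp add: cutoff_grad_def P_def[symmetric] abs_mult mult_ac)
  qed
  finally show ?thesis by simp
qed

lemma cutoff_outside_cell:
  assumes m: "0 < m" and k: "k \<noteq> cell A m j x"
  shows "cutoff A m j k x = 0" "cutoff_grad A m j k x = 0"
proof -
  obtain i where i: "k i \<noteq> \<lfloor>(real A * x $ i - real j) / real m\<rfloor>"
    using k by (auto simp: cell_def fun_eq_iff)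
  have out: "cell_coord A m j k x i \<le> 0 \<or> real m \<le> cell_coord A m j k x i"
  proof (rule ccontr)
    assume "\<not> ?thesis"
    then have "of_int (k i) \<le> (real A * x $ i - real j) / real m" "(real A * x $ i - real j) / real m < of_int (k i) + 1"
      using m by (auto simp: cell_coord_def field_simps)
    then show False using i floor_unique by metis
  qed
  note out = plateau_outside[OF out]
  show "cutoff A m j k x = 0" unfolding cutoff_def using out by (intro prod_zero) auto
  show "cutoff_grad A m j k x = 0"
  proof -
    have "cutoff_grad A m j k x $ l = 0" for l
    proof (cases "l = i")
      case True
      then show ?thesis by (simp add: cutoff_grad_def out)
    next
      case False
      then have "(\<Prod>l\<in>UNIV - {l}. plateau (real m) (cell_coord A m j k x l)) = 0"
        using out by (intro prod_zero) auto
      then show ?thesis by (simp add: cutoff_grad_def)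
    qed
    then show ?thesis by (simp add: vec_eq_iff)
  qed
qed

text \<open>A point of the cell with a coordinate outside \<open>{1/2..m - 1/2}\<close> would be closer than half a tick to one of
the two bounding hyperplanes, and its nearest tick would be congruent to \<open>j\<close>.\<close>

lemma cutoff_off_layer:
  assumes m: "0 < m" and j: "j < m" and x: "x \<notin> layer A m j"
  shows "cutoff A m j (cell A m j x) x = 1" "cutoff_grad A m j (cell A m j x) x = 0"
proof -
  have "1/2 \<le> cell_coord A m j (cell A m j x) x i \<and> cell_coord A m j (cell A m j x) x i \<le> real m - 1/2" for i
  proof -
    define k where "k = cell A m j x i"
    have t: "cell_coord A m j (cell A m j x) x i = real A * x $ i - real j - real m * of_int k"
      by (simp add: cell_coord_def k_def)
    have "of_int k \<le> (real A * x $ i - real j) / real m" "(real A * x $ i - real j) / real m < of_int k + 1"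
      unfolding k_def cell_def by (rule of_int_floor_le, rule real_of_int_floor_add_one_gt)
    then have k: "real m * of_int k \<le> real A * x $ i - real j" "real A * x $ i - real j < real m * of_int k + real m"
      using m by (auto simp: field_simps)
    have nl: "round (real A * x $ i) \<noteq> int j + int m * l" for l
      using x j m unfolding layer_def by (auto dest: spec[of _ i])
    show ?thesis
    proof (rule ccontr)
      assume n: "\<not> ?thesis"
      then consider "real A * x $ i - real j - real m * of_int k < 1/2" | "real A * x $ i - real j - real m * of_int k > real m - 1/2"
        unfolding t by linarith
      then show False
      proof cases
        case 1
        then have "\<bar>real A * x $ i - of_int (int j + int m * k)\<bar> < 1/2" using k by auto
        then show False using nl round_unique' by blast
      next
        case 2
        then have "\<bar>real A * x $ i - of_int (int j + int m * (k + 1))\<bar> < 1/2" using k by (auto simp: distrib_left)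
        then show False using nl round_unique' by blast
      qed
    qed
  qed
  note in1 = plateau_inside[of "cell_coord A m j (cell A m j x) x _" "real m"] and in2 = this
  show "cutoff A m j (cell A m j x) x = 1" unfolding cutoff_def using in1 in2 by (intro prod.neutral) auto
  show "cutoff_grad A m j (cell A m j x) x = 0" using in1 in2 by (simp add: cutoff_grad_def vec_eq_iff)
qed

lemma finite_cells: 
  assumes m: "0 < m" and j: "j < m" and A: "0 < A"
  shows "finite (cell A m j ` (Q :: (real^'d) set))"
proof (rule finite_subset[OF _ finite_lattice_box])
  show "cell A m j ` (Q :: (real^'d) set) \<subseteq> lattice_box A"
  proof
    fix k assume "k \<in> cell A m j ` (Q :: (real^'d) set)"
    then obtain x :: "real^'d" where x: "x \<in> Q" "k = cell A m j x" by blast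
    have "k i \<in> {- int A..int A}" for i
    proof -
      have "0 < x $ i" "x $ i < 1" using x by (auto simp: Q_def)
      then have a: "0 \<le> real A * x $ i" "real A * x $ i \<le> real A * 1" by (auto intro!: mult_left_mono simp del: mult_1_right)
      have "- 1 \<le> (real A * x $ i - real j) / real m"
        using a(1) j m by (simp add: field_simps)
      then have "- 1 \<le> k i" by (simp add: x(2) cell_def le_floor_iff)
      have "real A * x $ i - real j \<le> real A" using a by simp
      also have "real A \<le> real A * real m" using m mult_left_mono[of 1 "real m" "real A"] by simp
      finally have "(real A * x $ i - real j) / real m \<le> real A"
        using m by (simp add: pos_divide_le_eq)
      then have "k i \<le> int A" unfolding x(2) cell_def by linarith
      then show ?thesis using \<open>- 1 \<le> k i\<close> A by auto
    qed
    then show "k \<in> lattice_box A" by (simp add: lattice_box_def)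
  qed
qed

lemma cell_diameter:
  fixes x y :: "real^'d"
  assumes m: "0 < m" and A: "0 < A" and eq: "cell A m j x = cell A m j y"
  shows "norm (x - y) \<le> real CARD('d) * (real m / real A)"
proof -
  have "\<bar>x $ i - y $ i\<bar> \<le> real m / real A" for i
  proof -
    define k where "k = cell A m j x i"
    have b: "real m * of_int k \<le> real A * z $ i - real j \<and> real A * z $ i - real j < real m * of_int k + real m" if "cell A m j z i = k" for z :: "real^'d"
    proof -
      have "of_int k \<le> (real A * z $ i - real j) / real m" "(real A * z $ i - real j) / real m < of_int k + 1"
        unfolding that[symmetric] cell_def by (rule of_int_floor_le, rule real_of_int_floor_add_one_gt)
      then show ?thesis using m by (auto simp: field_simps)
    qed
    have "real A * \<bar>x $ i - y $ i\<bar> = \<bar>real A * x $ i - real A * y $ i\<bar>"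
      by (simp add: abs_mult right_diff_distrib[symmetric])
    also have "\<dots> \<le> real m" using b[of x] b[of y] eq by (auto simp: k_def abs_le_iff)
    finally show ?thesis using A by (simp add: field_simps)
  qed
  then have "(\<Sum>i\<in>UNIV. \<bar>(x - y) $ i\<bar>) \<le> (\<Sum>i\<in>(UNIV::'d set). real m / real A)" by (intro sum_mono) simp
  then show ?thesis using norm_le_l1_cart[of "x - y"] by simp
qed

lemma layer_sets: "(layer A m j :: (real^'d) set) \<in> sets lebesgue"
proof -
  have "(layer A m j :: (real^'d) set) = (\<Union>i\<in>UNIV. \<Union>n\<in>{n. n mod int m = int j}. {x. \<lfloor>real A * x $ i + 1/2\<rfloor> = n})"
    by (auto simp: layer_def round_def)
  also have "\<dots> \<in> sets borel"
  proof (rule sets.finite_UN[OF finite], rule sets.countable_UN''[OF countableI_type])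
    fix i :: 'd and n y :: int
    have "{x::real^'d. \<lfloor>real A * x $ i + 1/2\<rfloor> = n} = {x. of_int n \<le> real A * x $ i + 1/2} \<inter> {x. real A * x $ i + 1/2 < of_int n + 1}"
      by (auto simp: floor_eq_iff)
    also have "\<dots> \<in> sets borel"
    proof (rule sets.Int)
      show "{x::real^'d. of_int n \<le> real A * x $ i + 1/2} \<in> sets borel"
        by (intro borel_closed closed_Collect_le continuous_intros)
      show "{x::real^'d. real A * x $ i + 1/2 < of_int n + 1} \<in> sets borel"
        by (intro borel_open open_Collect_less continuous_intros)
    qed
    finally show "{x::real^'d. \<lfloor>real A * x $ i + 1/2\<rfloor> = n} \<in> sets borel" .
  qed
  finally show ?thesis by simp
qed

lemma integrable_layer:
  fixes f :: "real^'d \<Rightarrow> real"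
  assumes "integrable (lebesgue_on Q) f"
  shows "integrable (lebesgue_on Q) (\<lambda>x. indicator (layer A m j) x * f x)"
proof (rule Bochner_Integration.integrable_bound[OF assms])
  have "indicat_real (layer A m j) \<in> borel_measurable (lebesgue_on Q)"
    by (rule measurable_restrict_space1) (rule borel_measurable_indicator[OF layer_sets])
  then show "(\<lambda>x. indicator (layer A m j) x * f x) \<in> borel_measurable (lebesgue_on Q)"
    using assms by (intro borel_measurable_times) auto
  show "AE x in lebesgue_on Q. norm (indicator (layer A m j) x * f x) \<le> norm (f x)"
    by (intro AE_I2) (simp add: indicator_def)
qed

text \<open>In each coordinate direction a point lies in the layer of exactly one offset, so the integrals over
the \<open>m\<close> layers add up to at most \<open>CARD('d)\<close> times the whole; some offset has at most the average.\<close>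

lemma layer_pigeonhole:
  fixes f :: "real^'d \<Rightarrow> real"
  assumes m: "0 < m" and f: "integrable (lebesgue_on Q) f" "\<And>x. 0 \<le> f x"
  shows "\<exists>j<m. real m * (LINT x|lebesgue_on Q. indicator (layer A m j) x * f x) \<le> real CARD('d) * (LINT x|lebesgue_on Q. f x)"
proof (rule ccontr)
  assume "\<not> ?thesis"
  then have less: "real CARD('d) * (LINT x|lebesgue_on Q. f x) < real m * (LINT x|lebesgue_on Q. indicator (layer A m j) x * f x)" if "j < m" for j
    using that by force
  note int = integrable_layer[OF f(1)]
  have "real m * (real CARD('d) * (LINT x|lebesgue_on Q. f x)) = (\<Sum>j<m. real CARD('d) * (LINT x|lebesgue_on Q. f x))"
    by simp
  also have "\<dots> < (\<Sum>j<m. real m * (LINT x|lebesgue_on Q. indicator (layer A m j) x * f x))"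
    using m less by (intro sum_strict_mono) auto
  also have "\<dots> = real m * (LINT x|lebesgue_on Q. (\<Sum>j<m. indicator (layer A m j) x * f x))"
    by (simp only: sum_distrib_left Bochner_Integration.integral_sum[OF int])
  also have "\<dots> \<le> real m * (LINT x|lebesgue_on Q. real CARD('d) * f x)"
  proof (intro mult_left_mono integral_mono)
    show "integrable (lebesgue_on Q) (\<lambda>x. \<Sum>j<m. indicator (layer A m j) x * f x)"
      by (rule Bochner_Integration.integrable_sum[OF int])
    show "integrable (lebesgue_on Q) (\<lambda>x. real CARD('d) * f x)"
      by (rule integrable_mult_right[OF f(1)])
    fix x :: "real^'d"
    have "(\<Sum>j<m. indicator (layer A m j) x) \<le> (\<Sum>j<m. \<Sum>i\<in>(UNIV::'d set). if int j = round (real A * x $ i) mod int m then 1 else (0::real))"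
    proof (intro sum_mono)
      fix j
      show "indicator (layer A m j) x \<le> (\<Sum>i\<in>(UNIV::'d set). if int j = round (real A * x $ i) mod int m then 1 else (0::real))"
      proof (cases "x \<in> layer A m j")
        case True
        then obtain i where i: "round (real A * x $ i) mod int m = int j" by (auto simp: layer_def)
        have "(if int j = round (real A * x $ i) mod int m then 1 else (0::real)) \<le>
           (\<Sum>i\<in>(UNIV::'d set). if int j = round (real A * x $ i) mod int m then 1 else (0::real))"
          by (rule member_le_sum) auto
        then show ?thesis using i True by simp
      qed (auto intro!: sum_nonneg)
    qed
    also have "\<dots> = (\<Sum>i\<in>(UNIV::'d set). \<Sum>j<m. if int j = round (real A * x $ i) mod int m then 1 else (0::real))"
      by (rule sum.swap)
    also have "\<dots> \<le> (\<Sum>i\<in>(UNIV::'d set). 1)"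
    proof (intro sum_mono)
      fix i :: 'd
      have "(\<Sum>j<m. if int j = round (real A * x $ i) mod int m then 1 else (0::real)) \<le>
        (\<Sum>j<m. if j = nat (round (real A * x $ i) mod int m) then 1 else (0::real))"
        by (intro sum_mono) auto
      also have "\<dots> \<le> 1" by (simp add: sum.delta)
      finally show "(\<Sum>j<m. if int j = round (real A * x $ i) mod int m then 1 else (0::real)) \<le> 1" .
    qed
    finally have "(\<Sum>j<m. indicator (layer A m j) x) * f x \<le> real CARD('d) * f x"
      using f(2) by (intro mult_right_mono) auto
    then show "(\<Sum>j<m. indicator (layer A m j) x * f x) \<le> real CARD('d) * f x"
      by (simp add: sum_distrib_right)
  qed simp
  finally show False by simp
qed

section \<open>The coercivity estimate\<close>

text \<open>The essential bound holds at every point of the cube, since a continuous function exceeds a bound on an open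
set, which is empty as soon as it is null.\<close>

lemma U_K_norm_le:
  fixes F :: "real^'d \<Rightarrow> real^'d^'d"
  assumes U: "(F, \<eta>) \<in> U_K \<omega> K" and x: "x \<in> Q"
  shows "norm (F x, \<eta> x) \<le> K"
proof -
  have c: "continuous_on UNIV F" "continuous_on UNIV \<eta>"
    and L: "Linf_norm Q F + Linf_norm Q \<eta> \<le> ereal K"
    using U by (auto simp: U_K_def C_per_def)
  define S where "S = {x \<in> Q. K < norm (F x) + norm (\<eta> x)}"
  define M where "M = esssup (lebesgue_on Q) (\<lambda>x. ereal (norm (F x)) + ereal (norm (\<eta> x)))"
  have M: "M \<le> ereal K"
    using esssup_add L unfolding Linf_norm_def M_def by (rule order_trans)
  have "AE x in lebesgue_on Q. ereal (norm (F x)) + ereal (norm (\<eta> x)) \<le> M"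
    unfolding M_def by (rule esssup_AE)
  then have "AE x in lebesgue_on Q. norm (F x) + norm (\<eta> x) \<le> K"
  proof eventually_elim
    case (elim x)
    then have "ereal (norm (F x)) + ereal (norm (\<eta> x)) \<le> ereal K" using M by (rule order_trans)
    then show ?case by simp
  qed
  then have "AE x in lebesgue. x \<in> Q \<longrightarrow> norm (F x) + norm (\<eta> x) \<le> K"
    by (subst (asm) AE_restrict_space_iff) auto
  then have "AE x in lebesgue. x \<notin> S" by eventually_elim (auto simp: S_def)
  then have "negligible S"
    by (simp add: negligible_iff_null_sets AE_iff_null_sets eventually_ae_filter)
       (metis (no_types, lifting) completion.complete2 mem_Collect_eq subsetI)
  moreover have "open S"
  proof -
    have "S = Q \<inter> {x. K < norm (F x) + norm (\<eta> x)}" by (auto simp: S_def)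
    then show ?thesis using Q_open c by (auto intro!: open_Int open_Collect_less continuous_intros)
  qed
  ultimately have "S = {}" using open_not_negligible by blast
  then have "norm (F x) + norm (\<eta> x) \<le> K" using x by (force simp: S_def)
  then show ?thesis using norm_Pair_le[of "F x" "\<eta> x"] by linarith
qed

lemma U_K_close:
  assumes \<omega>: "modulus_of_continuity \<omega>" and \<delta>: "\<delta> > 0"
  shows "\<exists>r>0. \<forall>(F, \<eta>) \<in> U_K \<omega> K. \<forall>x\<in>Q. \<forall>y\<in>Q. norm (x - y) < r \<longrightarrow>
     norm ((F x, \<eta> x) - (F y, \<eta> y)) < \<delta>"
proof -
  have "\<forall>\<^sub>F t in at_right 0. \<omega> t < \<delta>"
    using \<omega> \<delta> unfolding modulus_of_continuity_def by (intro order_tendstoD(2)) auto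
  then obtain r where r: "r > 0" "\<And>t. 0 < t \<Longrightarrow> t < r \<Longrightarrow> \<omega> t < \<delta>"
    by (auto simp: eventually_at_right_field)
  have "norm ((F x, \<eta> x) - (F y, \<eta> y)) < \<delta>"
    if U: "(F, \<eta>) \<in> U_K \<omega> K" and xy: "x \<in> Q" "y \<in> Q" "norm (x - y) < r" for F \<eta> x y
  proof -
    have "norm ((F x, \<eta> x) - (F y, \<eta> y)) \<le> norm (F x - F y) + \<bar>\<eta> x - \<eta> y\<bar>"
      using norm_Pair_le[of "F x - F y" "\<eta> x - \<eta> y"] by simp
    also have "\<dots> \<le> \<omega> (norm (x - y))"
      using U xy closure_subset[of Q] by (auto simp: U_K_def)
    also have "\<dots> < \<delta>"
      using r(2)[of "norm (x - y)"] xy \<omega> \<delta> by (cases "x = y") (auto simp: modulus_of_continuity_def)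
    finally show ?thesis .
  qed
  then show ?thesis using r(1) by blast
qed

lemma taylor_rem_0 [simp]: 
  assumes "Ck 3 e"
  shows "taylor_rem e w 0 = 0"
  using linear_0[OF linear_frechet_derivative[OF Ck3_partials(1)[OF assms]]] by (simp add: taylor_rem_def)

theorem theorem4:
  fixes p q K :: real
    and e :: "(real^'d^'d) \<times> real \<Rightarrow> real"
    and \<omega> :: "real \<Rightarrow> real"
  assumes "p \<ge> 2" and "q \<ge> 2"
    and "Ck 3 e"
    and "\<exists>c>0. \<exists>c'>0. \<forall>F \<eta>.
           c * (norm F powr p + \<bar>\<eta>\<bar> powr q - 1) \<le> e (F, \<eta>) \<and>
           e (F, \<eta>) \<le> c' * (norm F powr p + \<bar>\<eta>\<bar> powr q + 1)"
    and "\<exists>C>0. \<forall>F \<eta>.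
           norm (grad_F e (F, \<eta>)) \<le> C * (1 + norm F powr (p - 1) + \<bar>\<eta>\<bar> powr (q * (p - 1) / p)) \<and>
           \<bar>deriv_eta e (F, \<eta>)\<bar> \<le> C * (1 + norm F powr (p * (q - 1) / q) + \<bar>\<eta>\<bar> powr (q - 1))"
    and "strongly_quasiconvex p q e"
    and "K > 0"
    and "modulus_of_continuity \<omega>"
  shows "\<exists>C\<^sub>0>0. \<exists>C\<^sub>1>0. \<forall>(Fbar, \<eta>bar) \<in> U_K \<omega> K. \<forall>\<psi> \<in> Lp q Q. \<forall>\<phi> G.
           (LINT x|lebesgue_on Q. \<psi> x) = 0 \<longrightarrow> W1p0 p Q \<phi> G \<longrightarrow>
           (LINT x|lebesgue_on Q. \<bar>V p (G x)\<bar>\<^sup>2 + \<bar>V q (\<psi> x)\<bar>\<^sup>2)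
             \<le> C\<^sub>0 * (LINT x|lebesgue_on Q.
                       rel_energy e (Fbar x + G x, \<eta>bar x + \<psi> x) (Fbar x, \<eta>bar x))
               + C\<^sub>1 * (LINT x|lebesgue_on Q. \<bar>V p (\<phi> x)\<bar>\<^sup>2)"
proof -
  note p = \<open>p \<ge> 2\<close> and q = \<open>q \<ge> 2\<close> and e = \<open>Ck 3 e\<close>
  have pq0: "0 \<le> p" "0 \<le> q" and p1: "1 \<le> p" using p q by auto
  obtain A where A: "A \<ge> 0" "growth_controlled p q A e"
  proof -
    obtain c c' where c: "c > 0" "c' > 0" "\<And>F \<eta>. c * (norm F powr p + \<bar>\<eta>\<bar> powr q - 1) \<le> e (F, \<eta>) \<and>
           e (F, \<eta>) \<le> c' * (norm F powr p + \<bar>\<eta>\<bar> powr q + 1)"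
      using assms(4) by blast
    obtain C where C: "C > 0" "\<And>F \<eta>. norm (grad_F e (F, \<eta>)) \<le> C * (1 + norm F powr (p - 1) + \<bar>\<eta>\<bar> powr (q * (p - 1) / p)) \<and>
           \<bar>deriv_eta e (F, \<eta>)\<bar> \<le> C * (1 + norm F powr (p * (q - 1) / q) + \<bar>\<eta>\<bar> powr (q - 1))"
      using assms(5) by blast
    show ?thesis by (rule that[OF _ growth_controlled_of_bounds[OF p q e c C]]) (use c(1,2) C(1) in simp)
  qed
  obtain c\<^sub>0 where c0: "c\<^sub>0 > 0" and sq: "\<And>F \<eta> \<phi> G \<psi>. W1p_per p \<phi> G \<Longrightarrow> \<psi> \<in> Lp q Q \<Longrightarrow>
     c\<^sub>0 * (LINT x|lebesgue_on Q. \<bar>V p (G x)\<bar>\<^sup>2 + \<bar>V q (\<psi> x)\<bar>\<^sup>2)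
     \<le> (LINT x|lebesgue_on Q. e (F + G x, \<eta> + \<psi> x) - e (F, \<eta>) - deriv_eta e (F, \<eta>) * \<psi> x)"
    using assms(6) unfolding strongly_quasiconvex_def by blast
  obtain C where C: "C \<ge> 0" "\<And>w z. norm w \<le> K \<Longrightarrow> \<bar>taylor_rem e w z\<bar> \<le> C * excess p q z"
    using taylor_rem_le_excess[OF e A(2,1) pq0, of K] by blast
  have "c\<^sub>0 / 2 > 0" using c0 by simp
  then obtain \<delta> where \<delta>: "\<delta> > 0" "\<And>w v z. norm w \<le> K \<Longrightarrow> norm v \<le> K \<Longrightarrow> norm (w - v) < \<delta> \<Longrightarrow>
     \<bar>taylor_rem e w z - taylor_rem e v z\<bar> \<le> c\<^sub>0 / 2 * excess p q z"
    using taylor_rem_diff_le_excess[OF e A(2,1) pq0] by blast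
  obtain r where r: "r > 0" "\<And>F \<eta> x y. (F, \<eta>) \<in> U_K \<omega> K \<Longrightarrow> x \<in> Q \<Longrightarrow> y \<in> Q \<Longrightarrow> norm (x - y) < r \<Longrightarrow>
     norm ((F x :: real^'d^'d, \<eta> x) - (F y, \<eta> y)) < \<delta>"
    using U_K_close[OF assms(8) \<delta>(1), of K] by blast
  \<comment> \<open>The constants are chosen in this order: \<open>B\<close> is independent of the grid, \<open>m\<close> makes the layers thin
    enough to be absorbed, \<open>N\<close> makes the cells small enough for freezing the base state, and only \<open>\<Lambda>\<close> depends on both.\<close>
  define B where "B = 2 + 2 powr p"
  have B: "B \<ge> 0" by (simp add: B_def)
  define T where "T = c\<^sub>0 / 2 + C * (1 + B)"
  have T: "T \<ge> 0" using c0 C B by (simp add: T_def)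
  obtain m :: nat where m: "0 < m" "T * real CARD('d) / real m \<le> c\<^sub>0 / 4"
  proof -
    obtain m :: nat where "T * real CARD('d) / (c\<^sub>0 / 4) < real m" using reals_Archimedean2 by blast
    moreover have "0 \<le> T * real CARD('d) / (c\<^sub>0 / 4)" using T c0 by simp
    ultimately have "0 < real m" "T * real CARD('d) \<le> c\<^sub>0 / 4 * real m"
      using c0 by (linarith, simp add: field_simps)
    then show ?thesis using that[of m] by (simp add: pos_divide_le_eq)
  qed
  obtain N :: nat where N: "0 < N" "real CARD('d) / real N < r"
  proof -
    obtain N :: nat where "real CARD('d) / r < real N" using reals_Archimedean2 by blast
    moreover have "0 \<le> real CARD('d) / r" using r(1) by simp
    ultimately have "0 < real N" "real CARD('d) < r * real N"
      using r(1) by (linarith, simp add: field_simps)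
    then show ?thesis using that[of N] by (simp add: pos_divide_less_eq)
  qed
  define R where "R = N * m"
  have R: "0 < R" "real m / real R = 1 / real N" using N m by (auto simp: R_def)
  define L where "L = real CARD('d) * (8 * real R)"
  define \<Lambda> where "\<Lambda> = L\<^sup>2 + L powr p"
  have \<Lambda>: "\<Lambda> \<ge> 0" by (simp add: \<Lambda>_def)
  have main: "c\<^sub>0 / 4 * (LINT x|lebesgue_on Q. excess p q (G x, \<psi> x))
     \<le> (LINT x|lebesgue_on Q. taylor_rem e (F x, \<eta> x) (G x, \<psi> x)) + C * B * \<Lambda> * (LINT x|lebesgue_on Q. \<bar>V p (\<phi> x)\<bar>\<^sup>2)"
    if U: "(F, \<eta>) \<in> U_K \<omega> K" and \<psi>: "\<psi> \<in> Lp q Q" and W: "W1p0 p Q \<phi> G" for F \<eta> \<psi> \<phi> G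
  proof -
    have \<phi>: "\<phi> \<in> Lp p Q" and G: "G \<in> Lp p Q" using W by (auto simp: W1p0_def W1p_def)
    have z: "zero_trace_gradient \<phi> G" by (rule W1p0_zero_trace_gradient[OF W p1])
    have int\<phi>G: "integrable (lebesgue_on Q) \<phi>" "integrable (lebesgue_on Q) G"
      using Lp_integrable_norm(2)[OF \<phi> p1] Lp_integrable_norm(2)[OF G p1] .
    define w where "w x = (F x, \<eta> x)" for x
    have wc: "continuous_on UNIV w" using U unfolding w_def by (auto simp: U_K_def C_per_def intro!: continuous_intros)
    have wK: "norm (w x) \<le> K" if "x \<in> Q" for x unfolding w_def by (rule U_K_norm_le[OF U that])
    define E where "E x = excess p q (G x, \<psi> x)" for x
    have E: "integrable (lebesgue_on Q) E"
      unfolding E_def excess_def using Lp_integrable_V[OF G p] Lp_integrable_V[OF \<psi> q] by simp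
    have E0: "0 \<le> E x" for x by (simp add: E_def excess_nonneg)
    define v where "v x = \<bar>V p (\<phi> x)\<bar>\<^sup>2" for x
    have v: "integrable (lebesgue_on Q) v" unfolding v_def by (rule Lp_integrable_V[OF \<phi> p])
    have v0: "0 \<le> v x" for x by (simp add: v_def)
    obtain j where j: "j < m" "real m * (LINT x|lebesgue_on Q. indicator (layer R m j) x * E x) \<le> real CARD('d) * (LINT x|lebesgue_on Q. E x)"
      using layer_pigeonhole[OF m(1) E E0] by blast
    define Y where "Y = (layer R m j :: (real^'d) set)"
    define \<kappa> where "\<kappa> = (cell R m j :: real^'d \<Rightarrow> 'd \<Rightarrow> int)"
    define J where "J = \<kappa> ` Q"
    have J: "finite J" unfolding J_def \<kappa>_def by (rule finite_cells[OF m(1) j(1) R(1)])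
    have "\<forall>k\<in>J. \<exists>x\<in>Q. \<kappa> x = k" by (auto simp: J_def)
    then obtain x\<^sub>k where xk: "\<And>k. k \<in> J \<Longrightarrow> x\<^sub>k k \<in> Q" "\<And>k. k \<in> J \<Longrightarrow> \<kappa> (x\<^sub>k k) = k" by metis
    define \<rho> where "\<rho> = (cutoff R m j :: ('d \<Rightarrow> int) \<Rightarrow> real^'d \<Rightarrow> real)"
    define g where "g = (cutoff_grad R m j :: ('d \<Rightarrow> int) \<Rightarrow> real^'d \<Rightarrow> real^'d)"
    \<comment> \<open>The localized pairs, with one representative point \<open>x\<^sub>k k\<close> in each cell that meets \<open>Q\<close>.\<close>
    define G' where "G' k x = \<rho> k x *\<^sub>R G x + outer (\<phi> x) (g k x)" for k x
    define \<psi>' where "\<psi>' k x = \<rho> k x * \<psi> x" for k x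
    have \<rho>c: "continuous_on UNIV (\<rho> k)" and gc: "continuous_on UNIV (\<lambda>x. g k x $ i)" for k i
      using C1_along_cutoff[of _ R m j k] by (auto simp: \<rho>_def g_def C1_along_def)
    have gc: "continuous_on UNIV (g k)" for k
      using continuous_on_vec_lambda[of UNIV "\<lambda>i x. g k x $ i"] gc by simp
    have \<rho>01: "0 \<le> \<rho> k x" "\<rho> k x \<le> 1" for k x unfolding \<rho>_def by (rule cutoff_bounds)+
    have gL: "norm (g k x) \<le> L" for k x unfolding g_def L_def by (rule norm_cutoff_grad)
    have \<psi>': "\<psi>' k \<in> Lp q Q" for k
    proof (rule Lp_dominated[OF \<psi>])
      show "\<psi>' k \<in> borel_measurable (lebesgue_on Q)"
        unfolding \<psi>'_def using continuous_measurable_Q[OF \<rho>c] Lp_measurable[OF \<psi>] by (rule borel_measurable_times)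
      show "norm (\<psi>' k x) \<le> 1 * norm (\<psi> x)" for x
        unfolding \<psi>'_def using \<rho>01 by (simp add: abs_mult mult_left_le_one_le)
    qed (use pq0 in auto)
    have \<phi>': "(\<lambda>x. \<rho> k x *\<^sub>R \<phi> x) \<in> Lp p Q" for k
    proof (rule Lp_dominated[OF \<phi>])
      show "(\<lambda>x. \<rho> k x *\<^sub>R \<phi> x) \<in> borel_measurable (lebesgue_on Q)"
        using continuous_measurable_Q[OF \<rho>c] Lp_measurable[OF \<phi>] by (rule borel_measurable_scaleR)
      show "norm (\<rho> k x *\<^sub>R \<phi> x) \<le> 1 * norm (\<phi> x)" for x
        using \<rho>01 by (simp add: mult_left_le_one_le)
    qed (use pq0 in auto)
    have G': "G' k \<in> Lp p Q" for k
      unfolding G'_def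
    proof (rule Lp_add)
      show "(\<lambda>x. \<rho> k x *\<^sub>R G x) \<in> Lp p Q"
      proof (rule Lp_dominated[OF G])
        show "(\<lambda>x. \<rho> k x *\<^sub>R G x) \<in> borel_measurable (lebesgue_on Q)"
          using continuous_measurable_Q[OF \<rho>c] Lp_measurable[OF G] by (rule borel_measurable_scaleR)
        show "norm (\<rho> k x *\<^sub>R G x) \<le> 1 * norm (G x)" for x
          using \<rho>01 by (simp add: mult_left_le_one_le)
      qed (use pq0 in auto)
      show "(\<lambda>x. outer (\<phi> x) (g k x)) \<in> Lp p Q"
      proof (rule Lp_dominated[OF \<phi>])
        have "continuous_on UNIV (\<lambda>(a::real^'d, b::real^'d). outer a b)"
          unfolding outer_def split_beta by (intro continuous_intros)
        from borel_measurable_continuous_on[OF this borel_measurable_Pair[OF Lp_measurable[OF \<phi>] continuous_measurable_Q[OF gc]]]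
        show "(\<lambda>x. outer (\<phi> x) (g k x)) \<in> borel_measurable (lebesgue_on Q)" by simp
        show "norm (outer (\<phi> x) (g k x)) \<le> L * norm (\<phi> x)" for x
          unfolding norm_outer using mult_left_mono[OF gL, of "norm (\<phi> x)"] by (simp add: mult.commute)
      qed (use pq0 in \<open>auto simp: L_def\<close>)
    qed (use pq0 in auto)
    have z': "zero_trace_gradient (\<lambda>x. \<rho> k x *\<^sub>R \<phi> x) (G' k)" for k
      unfolding G'_def using C1_along_cutoff[of _ R m j k]
      by (intro zero_trace_gradient_cutoff z int\<phi>G) (simp add: \<rho>_def g_def)
    define Z where "Z k x = (G' k x, \<psi>' k x)" for k x
    have int_exc: "integrable (lebesgue_on Q) (\<lambda>x. excess p q (Z k x))" for k
      unfolding Z_def excess_def using Lp_integrable_V[OF G' p] Lp_integrable_V[OF \<psi>' q] by simp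
    have int_rem: "integrable (lebesgue_on Q) (\<lambda>x. taylor_rem e (w x) (Z k x))" for k
      unfolding Z_def by (rule integrable_taylor_rem[OF e G' \<psi>' p q wc wK C(2,1)])
    have Z0: "Z k x = 0" if "k \<noteq> \<kappa> x" for k x
      using cutoff_outside_cell[OF m(1), of k R j x] that
      by (simp add: Z_def G'_def \<psi>'_def \<rho>_def g_def \<kappa>_def outer_def vec_eq_iff prod_eq_iff)
    have Z1: "Z (\<kappa> x) x = (G x, \<psi> x)" if "x \<notin> Y" for x
      using cutoff_off_layer[OF m(1) j(1), of x R] that
      by (simp add: Z_def G'_def \<psi>'_def \<rho>_def g_def \<kappa>_def Y_def outer_def vec_eq_iff)
    have ZB: "excess p q (Z k x) \<le> B * (E x + \<Lambda> * v x)" for k x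
      unfolding Z_def G'_def \<psi>'_def B_def E_def \<Lambda>_def v_def by (rule excess_cutoff[OF pq0 \<rho>01 gL])
    \<comment> \<open>Quasiconvexity on a single cell, with the base state frozen at its representative point.\<close>
    have cell_est: "c\<^sub>0 / 2 * (LINT x|lebesgue_on Q. excess p q (Z k x)) \<le> (LINT x|lebesgue_on Q. taylor_rem e (w x) (Z k x))"
      if k: "k \<in> J" for k
    proof -
      have int_k: "integrable (lebesgue_on Q) (\<lambda>x. taylor_rem e (w (x\<^sub>k k)) (Z k x))"
        unfolding Z_def using wK[OF xk(1)[OF k]]
        by (intro integrable_taylor_rem[OF e G' \<psi>' p q continuous_on_const _ C(2,1)])
      have "c\<^sub>0 * (LINT x|lebesgue_on Q. excess p q (Z k x)) \<le> (LINT x|lebesgue_on Q. taylor_rem e (w (x\<^sub>k k)) (Z k x))"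
        using quasiconvexity_zero_trace[OF sq e z' \<phi>' G' \<psi>' p q int_k[unfolded Z_def]] unfolding Z_def by simp
      also have "\<dots> \<le> (LINT x|lebesgue_on Q. taylor_rem e (w x) (Z k x) + c\<^sub>0 / 2 * excess p q (Z k x))"
      proof (rule integral_mono[OF int_k])
        show "integrable (lebesgue_on Q) (\<lambda>x. taylor_rem e (w x) (Z k x) + c\<^sub>0 / 2 * excess p q (Z k x))"
          using int_rem int_exc by (intro Bochner_Integration.integrable_add integrable_mult_right) 
        fix x :: "real^'d" assume "x \<in> space (lebesgue_on Q)"
        then have x: "x \<in> Q" by simp
        show "taylor_rem e (w (x\<^sub>k k)) (Z k x) \<le> taylor_rem e (w x) (Z k x) + c\<^sub>0 / 2 * excess p q (Z k x)"
        proof (cases "k = \<kappa> x")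
          case True
          have "norm (x\<^sub>k k - x) \<le> real CARD('d) * (real m / real R)"
            using xk(2)[OF k] True by (intro cell_diameter[OF m(1) R(1)]) (auto simp: \<kappa>_def)
          then have "norm (x\<^sub>k k - x) < r" using N(2) by (simp add: R(2))
          then have "norm (w (x\<^sub>k k) - w x) < \<delta>" unfolding w_def by (rule r(2)[OF U xk(1)[OF k] x])
          from \<delta>(2)[OF wK[OF xk(1)[OF k]] wK[OF x] this, of "Z k x"] show ?thesis by linarith
        next
          case False
          then show ?thesis using Z0[OF False] e by simp
        qed
      qed
      also have "\<dots> = (LINT x|lebesgue_on Q. taylor_rem e (w x) (Z k x)) + c\<^sub>0 / 2 * (LINT x|lebesgue_on Q. excess p q (Z k x))"
        using int_rem int_exc by simp
      finally show ?thesis by simp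
    qed
    \<comment> \<open>At each point only the pair of the cell containing it can be non-zero, so sums over the cells reduce to one term at each point.\<close>
    have sum_J: "(\<Sum>k\<in>J. f (Z k x)) = f (Z (\<kappa> x) x)" if "x \<in> Q" "f 0 = 0" for x and f :: "(real^'d^'d) \<times> real \<Rightarrow> real"
    proof -
      have "(\<Sum>k\<in>J. f (Z k x)) = f (Z (\<kappa> x) x) + (\<Sum>k\<in>J - {\<kappa> x}. f (Z k x))"
        using J that by (intro sum.remove) (auto simp: J_def)
      also have "(\<Sum>k\<in>J - {\<kappa> x}. f (Z k x)) = 0" using Z0 that by (intro sum.neutral) auto
      finally show ?thesis by simp
    qed
    define I where "I = (LINT x|lebesgue_on Q. E x)"
    define IY where "IY = (LINT x|lebesgue_on Q. indicator Y x * E x)"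
    define IR where "IR = (LINT x|lebesgue_on Q. taylor_rem e (w x) (G x, \<psi> x))"
    define Iv where "Iv = (LINT x|lebesgue_on Q. v x)"
    have EY: "integrable (lebesgue_on Q) (\<lambda>x. indicator Y x * E x)" unfolding Y_def by (rule integrable_layer[OF E])
    have intR: "integrable (lebesgue_on Q) (\<lambda>x. taylor_rem e (w x) (G x, \<psi> x))"
      by (rule integrable_taylor_rem[OF e G \<psi> p q wc wK C(2,1)])
    have "c\<^sub>0 / 2 * (I - IY) = c\<^sub>0 / 2 * (LINT x|lebesgue_on Q. E x - indicator Y x * E x)"
      using E EY by (simp add: I_def IY_def)
    also have "\<dots> \<le> c\<^sub>0 / 2 * (LINT x|lebesgue_on Q. (\<Sum>k\<in>J. excess p q (Z k x)))"
    proof (intro mult_left_mono integral_mono)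
      show "integrable (lebesgue_on Q) (\<lambda>x. E x - indicator Y x * E x)" using E EY by simp
      show "integrable (lebesgue_on Q) (\<lambda>x. \<Sum>k\<in>J. excess p q (Z k x))" using int_exc by simp
      fix x :: "real^'d" assume "x \<in> space (lebesgue_on Q)"
      then have x: "x \<in> Q" by simp
      show "E x - indicator Y x * E x \<le> (\<Sum>k\<in>J. excess p q (Z k x))"
        unfolding sum_J[OF x, of "excess p q", OF excess_0]
        using Z1[of x] excess_nonneg[of p q "Z (\<kappa> x) x"] by (cases "x \<in> Y") (auto simp: E_def)
    qed (use c0 in simp)
    also have "\<dots> = (\<Sum>k\<in>J. c\<^sub>0 / 2 * (LINT x|lebesgue_on Q. excess p q (Z k x)))"
      by (simp only: Bochner_Integration.integral_sum[OF int_exc] sum_distrib_left)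
    also have "\<dots> \<le> (\<Sum>k\<in>J. LINT x|lebesgue_on Q. taylor_rem e (w x) (Z k x))"
      by (intro sum_mono cell_est)
    also have "\<dots> = (LINT x|lebesgue_on Q. (\<Sum>k\<in>J. taylor_rem e (w x) (Z k x)))"
      by (simp only: Bochner_Integration.integral_sum[OF int_rem])
    also have "\<dots> \<le> (LINT x|lebesgue_on Q. taylor_rem e (w x) (G x, \<psi> x) + (C * (1 + B) * (indicator Y x * E x) + C * B * \<Lambda> * v x))"
    proof (intro integral_mono)
      show "integrable (lebesgue_on Q) (\<lambda>x. \<Sum>k\<in>J. taylor_rem e (w x) (Z k x))" using int_rem by simp
      show "integrable (lebesgue_on Q) (\<lambda>x. taylor_rem e (w x) (G x, \<psi> x) + (C * (1 + B) * (indicator Y x * E x) + C * B * \<Lambda> * v x))"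
        by (intro Bochner_Integration.integrable_add integrable_mult_right intR EY v)
      fix x :: "real^'d" assume "x \<in> space (lebesgue_on Q)"
      then have x: "x \<in> Q" by simp
      have nn: "0 \<le> C * B * \<Lambda> * v x" using C(1) B \<Lambda> v0 by simp
      show "(\<Sum>k\<in>J. taylor_rem e (w x) (Z k x)) \<le> taylor_rem e (w x) (G x, \<psi> x) + (C * (1 + B) * (indicator Y x * E x) + C * B * \<Lambda> * v x)"
        unfolding sum_J[OF x, of "taylor_rem e (w x)", OF taylor_rem_0[OF e]]
      proof (cases "x \<in> Y")
        case False
        then show "taylor_rem e (w x) (Z (\<kappa> x) x) \<le> taylor_rem e (w x) (G x, \<psi> x) + (C * (1 + B) * (indicator Y x * E x) + C * B * \<Lambda> * v x)"
          using Z1 nn by simp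
      next
        case True
        have "\<bar>taylor_rem e (w x) (Z (\<kappa> x) x)\<bar> \<le> C * (B * (E x + \<Lambda> * v x))"
          using C(2)[OF wK[OF x]] mult_left_mono[OF ZB C(1)] by (rule order_trans)
        moreover have "\<bar>taylor_rem e (w x) (G x, \<psi> x)\<bar> \<le> C * E x"
          unfolding E_def by (rule C(2)[OF wK[OF x]])
        ultimately show "taylor_rem e (w x) (Z (\<kappa> x) x) \<le> taylor_rem e (w x) (G x, \<psi> x) + (C * (1 + B) * (indicator Y x * E x) + C * B * \<Lambda> * v x)"
          using True by (simp add: algebra_simps)
      qed
    qed
    also have "\<dots> = IR + (C * (1 + B) * IY + C * B * \<Lambda> * Iv)"
      using intR EY v unfolding IR_def IY_def Iv_def by simp
    finally have 1: "c\<^sub>0 / 2 * I \<le> IR + (T * IY + C * B * \<Lambda> * Iv)"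
      by (simp add: T_def algebra_simps)
    have I0: "I \<ge> 0" unfolding I_def using E0 by (intro integral_nonneg_AE AE_I2)
    \<comment> \<open>The layer carries only a small fraction of the total excess and is absorbed on the left.\<close>
    have "IY \<le> real CARD('d) / real m * I"
      using j(2) m(1) unfolding IY_def I_def Y_def by (simp add: field_simps)
    then have "T * IY \<le> T * (real CARD('d) / real m * I)" using T by (rule mult_left_mono)
    also have "\<dots> = T * real CARD('d) / real m * I" by simp
    also have "\<dots> \<le> c\<^sub>0 / 4 * I" using m(2) I0 by (rule mult_right_mono)
    finally have "c\<^sub>0 / 4 * I \<le> IR + C * B * \<Lambda> * Iv" using 1 by simp
    then show ?thesis unfolding I_def IR_def Iv_def E_def v_def w_def .
  qed
  define C\<^sub>1 where "C\<^sub>1 = 4 / c\<^sub>0 * (C * B * \<Lambda>) + 1"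
  have "4 / c\<^sub>0 > 0" using c0 by simp
  moreover have "C\<^sub>1 > 0" using c0 C(1) B \<Lambda> by (simp add: C\<^sub>1_def add_nonneg_pos)
  moreover have "(LINT x|lebesgue_on Q. \<bar>V p (G x)\<bar>\<^sup>2 + \<bar>V q (\<psi> x)\<bar>\<^sup>2)
     \<le> 4 / c\<^sub>0 * (LINT x|lebesgue_on Q. rel_energy e (F x + G x, \<eta> x + \<psi> x) (F x, \<eta> x))
       + C\<^sub>1 * (LINT x|lebesgue_on Q. \<bar>V p (\<phi> x)\<bar>\<^sup>2)"
    if U: "(F, \<eta>) \<in> U_K \<omega> K" and \<psi>: "\<psi> \<in> Lp q Q" and W: "W1p0 p Q \<phi> G" for F \<eta> \<psi> \<phi> G
  proof -
    define I where "I = (LINT x|lebesgue_on Q. excess p q (G x, \<psi> x))"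
    define IR where "IR = (LINT x|lebesgue_on Q. taylor_rem e (F x, \<eta> x) (G x, \<psi> x))"
    define Iv where "Iv = (LINT x|lebesgue_on Q. \<bar>V p (\<phi> x)\<bar>\<^sup>2)"
    have Iv0: "Iv \<ge> 0" unfolding Iv_def by (intro integral_nonneg_AE AE_I2) simp
    have rel: "rel_energy e (F x + G x, \<eta> x + \<psi> x) (F x, \<eta> x) = taylor_rem e (F x, \<eta> x) (G x, \<psi> x)" for x
      using rel_energy_eq_taylor_rem[OF e, of "(F x, \<eta> x)" "(G x, \<psi> x)"] by simp
    have "c\<^sub>0 / 4 * I \<le> IR + C * B * \<Lambda> * Iv"
      using main[OF U \<psi> W] unfolding I_def IR_def Iv_def .
    then have "I \<le> 4 / c\<^sub>0 * IR + 4 / c\<^sub>0 * (C * B * \<Lambda>) * Iv"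
      using c0 by (simp add: field_simps)
    also have "\<dots> \<le> 4 / c\<^sub>0 * IR + C\<^sub>1 * Iv"
      using Iv0 by (simp add: C\<^sub>1_def distrib_right)
    finally show ?thesis
      unfolding I_def IR_def Iv_def rel excess_def by simp
  qed
  ultimately show ?thesis by blast
qed

end
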